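(* Let $G$ be a finite simple graph, let $\pi=\{W_1,\ldots,W_r\}$ be a clique partition of $G$ with $W_a=\{x_{a,1},\ldots,x_{a,|W_a|}\}$, let $n_1,\ldots,n_r$ be positive integers, and let $\Gamma=G^\pi[n_1,\ldots,n_r]$ be the multi-clique-whiskered graph of $G$ with respect to $\pi$, with whisker vertices $w_{a,1},\ldots,w_{a,n_a}$ ($1\le a\le r$). Let $S=\Bbbk[V(\Gamma)]$ and put $\mathbf{w}_a=w_{a,1}\cdots w_{a,n_a}$. Order $V(G)$ by $$x_{1,1}<\cdots<x_{1,|W_1|}<x_{2,1}<\cdots<x_{2,|W_2|}<\cdots<x_{r,1}<\cdots<x_{r,|W_r|}.$$ For $p\ge0$ let $F_p$ be the free $S$-module with basis the symbols $\mathbf{f}(C;\sigma)$ of multidegree $\mathbf{z}_C\mathbf{x}_\sigma$, where $C$ runs over the minimal vertex covers of $\Gamma$ and $\sigma$ runs over the subsets of $V(G)\setminus C$ with $|\sigma|=p$. Let $d_0:F_0\to J(\Gamma)$ be given by $d_0(\mathbf{f}(C;\emptyset))=\mathbf{z}_C$, and for $p>0$ let $d_p:F_p\to F_{p-1}$ be given by $$d_p(\mathbf{f}(C;\sigma))=\sum_{x_{a,b}\in\sigma}(-1)^{\alpha(\sigma;x_{a,b})}\Big[\mathbf{w}_a\,\mathbf{f}\big((C\setminus\{w_{a,1},\ldots,w_{a,n_a}\})\cup\{x_{a,b}\};\sigma\setminus\{x_{a,b}\}\big)-x_{a,b}\,\mathbf{f}\big(C;\sigma\setminus\{x_{a,b}\}\big)\Big],$$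 where $\alpha(\sigma;x_{a,b})=|\{x_{s,t}\in\sigma: x_{s,t}>x_{a,b}\}|$. Then $$\mathbb{F}:\cdots\to F_p\xrightarrow{d_p}F_{p-1}\to\cdots\xrightarrow{d_1}F_0\xrightarrow{d_0}J(\Gamma)\to0$$ is a minimal free resolution of the cover ideal $J(\Gamma)$.
   Context: $\Bbbk$ is an arbitrary field. A clique partition $\pi=\{W_1,\ldots,W_r\}$ of $G$ is a family of cliques (vertex sets inducing complete subgraphs) whose disjoint union is $V(G)$. The multi-clique-whiskered graph $G^\pi[n_1,\ldots,n_r]$ has vertex set $V(G)\cup\{w_{a,k}:1\le a\le r,\ 1\le k\le n_a\}$ (new vertices $w_{a,k}$) and edge set $E(G)\cup\bigcup_{a=1}^r\{\{x,w_{a,k}\}: x\in W_a,\ 1\le k\le n_a\}$. Minimal vertex covers are minimal with respect to inclusion. The cover ideal $J(\Gamma)\subseteq\Bbbk[V(\Gamma)]$ is generated by the monomials $\prod_{v\in C}v$, $C$ a vertex cover of $\Gamma$. For $C\subseteq V(\Gamma)$, $\mathbf{z}_C=\prod_{v\in C}v$; for $\sigma\subseteq V(G)$, $\mathbf{x}_\sigma=\prod_{x\in\sigma}x$. *)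

theory Defs
  imports
    "HOL-Algebra.Module"
    "HOL-Algebra.Ideal"
    "HOL-Library.Poly_Mapping"
    "HOL-Library.Disjoint_Sets"
    "HOL-Library.FuncSet"
begin

section \<open>Graphs\<close>

definition simple_graph :: "'v set \<Rightarrow> 'v set set \<Rightarrow> bool" where
  "simple_graph V E \<longleftrightarrow> finite V \<and> (\<forall>e\<in>E. \<exists>u\<in>V. \<exists>v\<in>V. u \<noteq> v \<and> e = {u, v})"

definition clique :: "'v set \<Rightarrow> 'v set set \<Rightarrow> 'v set \<Rightarrow> bool" where
  "clique V E W \<longleftrightarrow> W \<subseteq> V \<and> (\<forall>u\<in>W. \<forall>v\<in>W. u \<noteq> v \<longrightarrow> {u, v} \<in> E)"

definition vertex_cover :: "'v set \<Rightarrow> 'v set set \<Rightarrow> 'v set \<Rightarrow> bool" where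
  "vertex_cover V E C \<longleftrightarrow> C \<subseteq> V \<and> (\<forall>e\<in>E. e \<inter> C \<noteq> {})"

definition min_vertex_cover :: "'v set \<Rightarrow> 'v set set \<Rightarrow> 'v set \<Rightarrow> bool" where
  "min_vertex_cover V E C \<longleftrightarrow> vertex_cover V E C \<and> (\<forall>D. D \<subset> C \<longrightarrow> \<not> vertex_cover V E D)"

text \<open>The cliques are \<open>W 1, \<dots>, W r\<close>; the values of \<open>W\<close> at other indices are irrelevant.
  Empty cliques are permitted.\<close>

definition clique_partition :: "'v set \<Rightarrow> 'v set set \<Rightarrow> nat \<Rightarrow> (nat \<Rightarrow> 'v set) \<Rightarrow> bool" where
  "clique_partition V E r W \<longleftrightarrow>
     (\<forall>a\<in>{1..r}. clique V E (W a)) \<and> disjoint_family_on W {1..r} \<and> (\<Union>a\<in>{1..r}. W a) = V"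

datatype 'v wvertex = Old 'v | Whisker nat nat

definition whisker_block :: "(nat \<Rightarrow> nat) \<Rightarrow> nat \<Rightarrow> 'v wvertex set" where
  "whisker_block n a = {Whisker a k | k. k \<in> {1..n a}}"

definition whiskered_vertices :: "'v set \<Rightarrow> nat \<Rightarrow> (nat \<Rightarrow> nat) \<Rightarrow> 'v wvertex set" where
  "whiskered_vertices V r n = Old ` V \<union> (\<Union>a\<in>{1..r}. whisker_block n a)"

definition whiskered_edges ::
    "'v set set \<Rightarrow> nat \<Rightarrow> (nat \<Rightarrow> 'v set) \<Rightarrow> (nat \<Rightarrow> nat) \<Rightarrow> 'v wvertex set set" where
  "whiskered_edges E r W n =
     (\<lambda>e. Old ` e) ` E \<union> (\<Union>a\<in>{1..r}. {{Old x, w} | x w. x \<in> W a \<and> w \<in> whisker_block n a})"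

section \<open>Polynomial rings\<close>

type_synonym 'x monomial = "'x \<Rightarrow>\<^sub>0 nat"
type_synonym ('x, 'k) mpoly = "'x monomial \<Rightarrow>\<^sub>0 'k"

definition polys_in :: "'x set \<Rightarrow> ('x, 'k::field) mpoly set" where
  "polys_in X = {p. \<forall>t\<in>Poly_Mapping.keys p. Poly_Mapping.keys t \<subseteq> X}"

definition poly_ring :: "'x set \<Rightarrow> ('x, 'k::field) mpoly ring" where
  "poly_ring X = \<lparr>carrier = polys_in X, monoid.mult = (*), one = 1, zero = 0, add = (+)\<rparr>"

definition var :: "'x \<Rightarrow> ('x, 'k::field) mpoly" where
  "var v = Poly_Mapping.single (Poly_Mapping.single v 1) 1"

definition sqfree_monom :: "'x set \<Rightarrow> ('x, 'k::field) mpoly" where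
  "sqfree_monom C = (\<Prod>v\<in>C. var v)"

definition irrelevant_ideal :: "'x set \<Rightarrow> ('x, 'k::field) mpoly set" where
  "irrelevant_ideal X = Idl\<^bsub>poly_ring X\<^esub> (var ` X)"

definition cover_ideal :: "'x set \<Rightarrow> 'x set set \<Rightarrow> ('x, 'k::field) mpoly set" where
  "cover_ideal V E = Idl\<^bsub>poly_ring V\<^esub> {sqfree_monom C | C. vertex_cover V E C}"

section \<open>Modules and free resolutions\<close>

text \<open>The record type of modules extends that of rings, so a module carries dummy entries
  \<open>mult\<close> and \<open>one\<close>; only \<open>carrier\<close>, \<open>zero\<close>, \<open>add\<close> and \<open>smult\<close> are meaningful.\<close>

definition ideal_module :: "('x, 'k::field) mpoly set \<Rightarrow> (('x, 'k) mpoly, ('x, 'k) mpoly) module" where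
  "ideal_module J = \<lparr>carrier = J, monoid.mult = undefined, one = undefined,
     zero = 0, add = (+), smult = (*)\<rparr>"

definition module_hom :: "('a, 'm) ring_scheme \<Rightarrow> ('a, 'b) module \<Rightarrow> ('a, 'c) module \<Rightarrow> ('b \<Rightarrow> 'c) set" where
  "module_hom R M N = {h \<in> carrier M \<rightarrow> carrier N.
     (\<forall>x\<in>carrier M. \<forall>y\<in>carrier M. h (x \<oplus>\<^bsub>M\<^esub> y) = h x \<oplus>\<^bsub>N\<^esub> h y) \<and>
     (\<forall>a\<in>carrier R. \<forall>x\<in>carrier M. h (a \<odot>\<^bsub>M\<^esub> x) = a \<odot>\<^bsub>N\<^esub> h x)}"

definition module_ker :: "('a, 'b) module \<Rightarrow> ('a, 'c) module \<Rightarrow> ('b \<Rightarrow> 'c) \<Rightarrow> 'b set" where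
  "module_ker M N h = {x \<in> carrier M. h x = \<zero>\<^bsub>N\<^esub>}"

definition module_basis :: "('a, 'm) ring_scheme \<Rightarrow> ('a, 'b) module \<Rightarrow> 'b set \<Rightarrow> bool" where
  "module_basis R M B \<longleftrightarrow> finite B \<and> B \<subseteq> carrier M \<and>
     (\<forall>x\<in>carrier M. \<exists>!c. c \<in> B \<rightarrow>\<^sub>E carrier R \<and> x = (\<Oplus>\<^bsub>M\<^esub>b\<in>B. c b \<odot>\<^bsub>M\<^esub> b))"

text \<open>The submodule \<open>I M\<close>.\<close>

definition ideal_smult :: "('a, 'm) ring_scheme \<Rightarrow> 'a set \<Rightarrow> ('a, 'b) module \<Rightarrow> 'b set" where
  "ideal_smult R I M =
     \<Inter>{H. submodule H R M \<and> (\<forall>a\<in>I. \<forall>x\<in>carrier M. a \<odot>\<^bsub>M\<^esub> x \<in> H)}"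

text \<open>The maps are \<open>d p : F p \<rightarrow> F (p - 1)\<close> for \<open>p > 0\<close> and the augmentation
  \<open>\<epsilon> : F 0 \<rightarrow> N\<close>, which needs a name of its own because its codomain has a different type.
  The value \<open>d 0\<close> is not used.\<close>

definition free_resolution ::
    "('a, 'm) ring_scheme \<Rightarrow> (nat \<Rightarrow> ('a, 'b) module) \<Rightarrow> (nat \<Rightarrow> 'b \<Rightarrow> 'b) \<Rightarrow> ('b \<Rightarrow> 'c) \<Rightarrow>
     ('a, 'c) module \<Rightarrow> bool" where
  "free_resolution R F d \<epsilon> N \<longleftrightarrow>
     module R N \<and>
     (\<forall>p. module R (F p) \<and> (\<exists>B. module_basis R (F p) B)) \<and>
     \<epsilon> \<in> module_hom R (F 0) N \<and>
     (\<forall>p>0. d p \<in> module_hom R (F p) (F (p - 1))) \<and>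
     \<epsilon> ` carrier (F 0) = carrier N \<and>
     d 1 ` carrier (F 1) = module_ker (F 0) N \<epsilon> \<and>
     (\<forall>p>0. d (p + 1) ` carrier (F (p + 1)) = module_ker (F p) (F (p - 1)) (d p))"

definition minimal_free_resolution ::
    "('a, 'm) ring_scheme \<Rightarrow> 'a set \<Rightarrow> (nat \<Rightarrow> ('a, 'b) module) \<Rightarrow> (nat \<Rightarrow> 'b \<Rightarrow> 'b) \<Rightarrow> ('b \<Rightarrow> 'c) \<Rightarrow>
     ('a, 'c) module \<Rightarrow> bool" where
  "minimal_free_resolution R \<mm> F d \<epsilon> N \<longleftrightarrow>
     free_resolution R F d \<epsilon> N \<and>
     (\<forall>p>0. d p ` carrier (F p) \<subseteq> ideal_smult R \<mm> (F (p - 1)))"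

section \<open>Free modules on a set of symbols, with multidegrees\<close>

text \<open>The basis element belonging to the symbol \<open>b\<close> is \<open>Poly_Mapping.single b 1\<close>.\<close>

type_synonym ('b, 'x, 'k) free_elem = "'b \<Rightarrow>\<^sub>0 ('x, 'k) mpoly"

definition scale :: "('x, 'k::field) mpoly \<Rightarrow> ('b, 'x, 'k) free_elem \<Rightarrow> ('b, 'x, 'k) free_elem" where
  "scale c \<phi> = Poly_Mapping.map (\<lambda>q. c * q) \<phi>"

definition free_module ::
    "'x set \<Rightarrow> 'b set \<Rightarrow> (('x, 'k::field) mpoly, ('b, 'x, 'k) free_elem) module" where
  "free_module X B =
     \<lparr>carrier = {\<phi>. Poly_Mapping.keys \<phi> \<subseteq> B \<and> (\<forall>b. Poly_Mapping.lookup \<phi> b \<in> polys_in X)},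
      monoid.mult = undefined, one = undefined, zero = 0, add = (+), smult = scale\<rparr>"

text \<open>The homogeneous components of multidegree \<open>m\<close> of a set of polynomials, and of the free
  module on \<open>B\<close> in which the basis element of \<open>b\<close> has multidegree \<open>deg b\<close>.\<close>

definition poly_component :: "('x, 'k::field) mpoly set \<Rightarrow> 'x monomial \<Rightarrow> ('x, 'k) mpoly set" where
  "poly_component J m = {q \<in> J. Poly_Mapping.keys q \<subseteq> {m}}"

definition free_component ::
    "'x set \<Rightarrow> 'b set \<Rightarrow> ('b \<Rightarrow> 'x monomial) \<Rightarrow> 'x monomial \<Rightarrow> ('b, 'x, 'k::field) free_elem set" where
  "free_component X B deg m =
     {\<phi> \<in> carrier (free_module X B). \<forall>b. \<forall>t\<in>Poly_Mapping.keys (Poly_Mapping.lookup \<phi> b). t + deg b = m}"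

section \<open>The complex\<close>

type_synonym 'v symb = "'v wvertex set \<times> 'v set"

definition symbols ::
    "'v set \<Rightarrow> 'v set set \<Rightarrow> nat \<Rightarrow> (nat \<Rightarrow> 'v set) \<Rightarrow> (nat \<Rightarrow> nat) \<Rightarrow> nat \<Rightarrow> 'v symb set" where
  "symbols V E r W n p =
     {(C, \<sigma>). min_vertex_cover (whiskered_vertices V r n) (whiskered_edges E r W n) C \<and>
              \<sigma> \<subseteq> {x\<in>V. Old x \<notin> C} \<and> card \<sigma> = p}"

definition symbol_deg :: "'v symb \<Rightarrow> 'v wvertex monomial" where
  "symbol_deg = (\<lambda>(C, \<sigma>).
     (\<Sum>v\<in>C. Poly_Mapping.single v 1) + (\<Sum>x\<in>\<sigma>. Poly_Mapping.single (Old x) 1))"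

definition cover_module ::
    "'v set \<Rightarrow> 'v set set \<Rightarrow> nat \<Rightarrow> (nat \<Rightarrow> 'v set) \<Rightarrow> (nat \<Rightarrow> nat) \<Rightarrow> nat \<Rightarrow>
     (('v wvertex, 'k::field) mpoly, ('v symb, 'v wvertex, 'k) free_elem) module" where
  "cover_module V E r W n p = free_module (whiskered_vertices V r n) (symbols V E r W n p)"

definition f_symbol :: "'v wvertex set \<Rightarrow> 'v set \<Rightarrow> ('v symb, 'v wvertex, 'k::field) free_elem" where
  "f_symbol C \<sigma> = Poly_Mapping.single (C, \<sigma>) 1"

text \<open>Here \<open>x a b\<close> is the \<open>b\<close>-th vertex of \<open>W a\<close>.\<close>

definition vertex_indices :: "nat \<Rightarrow> (nat \<Rightarrow> 'v set) \<Rightarrow> (nat \<times> nat) set" where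
  "vertex_indices r W = {(a, b). a \<in> {1..r} \<and> b \<in> {1..card (W a)}}"

definition sign_exponent ::
    "nat \<Rightarrow> (nat \<Rightarrow> 'v set) \<Rightarrow> (nat \<Rightarrow> nat \<Rightarrow> 'v) \<Rightarrow> 'v set \<Rightarrow> nat \<Rightarrow> nat \<Rightarrow> nat" where
  "sign_exponent r W x \<sigma> a b =
     card {x s t | s t. (s, t) \<in> vertex_indices r W \<and> x s t \<in> \<sigma> \<and> (a < s \<or> a = s \<and> b < t)}"

definition symbol_boundary ::
    "nat \<Rightarrow> (nat \<Rightarrow> 'v set) \<Rightarrow> (nat \<Rightarrow> nat) \<Rightarrow> (nat \<Rightarrow> nat \<Rightarrow> 'v) \<Rightarrow> 'v wvertex set \<Rightarrow> 'v set \<Rightarrow>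
     ('v symb, 'v wvertex, 'k::field) free_elem" where
  "symbol_boundary r W n x C \<sigma> =
     (\<Sum>(a, b) \<in> {(a, b) \<in> vertex_indices r W. x a b \<in> \<sigma>}.
        scale ((-1) ^ sign_exponent r W x \<sigma> a b)
          (scale (sqfree_monom (whisker_block n a))
                 (f_symbol ((C - whisker_block n a) \<union> {Old (x a b)}) (\<sigma> - {x a b}))
           - scale (var (Old (x a b))) (f_symbol C (\<sigma> - {x a b}))))"

text \<open>The linear extensions of the maps prescribed on basis elements. One formula serves all \<open>p > 0\<close>;
  that its values on \<open>F p\<close> lie in \<open>F (p - 1)\<close> is not built in.\<close>

definition differential ::
    "nat \<Rightarrow> (nat \<Rightarrow> 'v set) \<Rightarrow> (nat \<Rightarrow> nat) \<Rightarrow> (nat \<Rightarrow> nat \<Rightarrow> 'v) \<Rightarrow>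
     ('v symb, 'v wvertex, 'k::field) free_elem \<Rightarrow> ('v symb, 'v wvertex, 'k) free_elem" where
  "differential r W n x \<phi> =
     (\<Sum>(C, \<sigma>)\<in>Poly_Mapping.keys \<phi>. scale (Poly_Mapping.lookup \<phi> (C, \<sigma>)) (symbol_boundary r W n x C \<sigma>))"

definition augmentation ::
    "('v symb, 'v wvertex, 'k::field) free_elem \<Rightarrow> ('v wvertex, 'k) mpoly" where
  "augmentation \<phi> = (\<Sum>(C, \<sigma>)\<in>Poly_Mapping.keys \<phi>. Poly_Mapping.lookup \<phi> (C, \<sigma>) * sqfree_monom C)"

end

theory Submission
  imports Defs
begin

text \<open>
  A minimal vertex cover \<open>C\<close> of the whiskered graph is determined by the independent set
  \<open>V - C\<close> of \<open>G\<close> (\<open>min_vertex_cover_iff\<close>, \<open>min_vertex_cover_eqI\<close>), and every independent set occurs.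
  In a fixed multidegree the complex is therefore the cellular chain complex of a cubical complex:
  its cubes are the intervals between two independent sets that contain the vertices not dividing the
  multidegree and meet only cliques whose whiskers divide it. Such a complex is empty or contractible.
  The contraction can be carried out one vertex at a time, and directly on the free modules, without
  passing to multidegrees.

  For a vertex \<open>v\<close> of \<open>G\<close> let \<open>h\<^sub>v\<close> be the field-linear map that takes the term \<open>t f(C; \<sigma>)\<close>, \<open>t\<close> a
  monomial, to \<open>\<plusminus> (t / v) f(C; \<sigma> \<union> {v})\<close> if \<open>v\<close> divides \<open>t\<close> and \<open>v \<notin> C \<union> \<sigma>\<close>, and to \<open>0\<close> otherwise.
  The map \<open>id - d h\<^sub>v - h\<^sub>v d\<close> has its values in the span of the terms that are reduced at \<open>v\<close>: those
  with \<open>v \<notin> \<sigma>\<close> such that \<open>v\<close> is in \<open>C\<close> or does not divide \<open>t\<close>. It also preserves reducedness at every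
  other vertex (\<open>homotopy_identity\<close>). As \<open>d d = 0\<close>, every cycle is homologous to a combination of terms
  that are reduced at all vertices of \<open>G\<close> (\<open>cycle_reduction\<close>). In such a term \<open>\<sigma>\<close> is empty. Hence there
  are none in positive homological degree, and the complex is exact there. In degree \<open>0\<close> the
  augmentation is injective on their span, because in the monomial \<open>t z\<^sub>C\<close> of a reduced term exactly the
  vertices of \<open>G\<close> outside \<open>C\<close> fail to occur. A cycle of the augmented complex is therefore a boundary
  (\<open>exact_zero\<close>).

  The image of the augmentation is the cover ideal because every vertex cover contains a minimal one.
  Minimality holds because the coefficients of \<open>d\<close> on the symbols are the nonconstant monomials
  \<open>\<plusminus> w\<^sub>a\<close> and \<open>\<plusminus> x\<close>; here every clique needs at least one whisker.
\<close>

section \<open>Terms in free modules\<close>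

abbreviation coeff :: "('a \<Rightarrow>\<^sub>0 'b::zero) \<Rightarrow> 'a \<Rightarrow> 'b" where
  "coeff \<equiv> Poly_Mapping.lookup"

abbreviation supp :: "('a \<Rightarrow>\<^sub>0 'b::zero) \<Rightarrow> 'a set" where
  "supp \<equiv> Poly_Mapping.keys"

text \<open>The term \<open>c t b\<close> of a free module, for a symbol \<open>b\<close>, a monomial \<open>t\<close> and a scalar \<open>c\<close>.\<close>

definition fterm :: "'b \<Rightarrow> 'x monomial \<Rightarrow> 'k::field \<Rightarrow> ('b, 'x, 'k) free_elem" where
  "fterm b t c = Poly_Mapping.single b (Poly_Mapping.single t c)"

text \<open>The span over the field of a set of pairs of symbols and monomials. Free modules, their homogeneous
  components and the subspaces that occur in the homotopy argument are all of this form.\<close>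

definition term_span :: "('b \<times> 'x monomial) set \<Rightarrow> ('b, 'x, 'k::field) free_elem set" where
  "term_span T = {\<phi>. \<forall>b. \<forall>t\<in>supp (coeff \<phi> b). (b, t) \<in> T}"

lemma supp_add_subset: "supp (p + q) \<subseteq> supp p \<union> supp q"
  by (rule Poly_Mapping.keys_add)

lemma supp_minus: "supp (- p :: 'a \<Rightarrow>\<^sub>0 'b::ab_group_add) = supp p"
  by (auto simp: in_keys_iff)

lemma poly_mapping_sum_single: "(\<Sum>b\<in>supp \<phi>. Poly_Mapping.single b (coeff \<phi> b)) = \<phi>"
proof (rule poly_mapping_eqI)
  fix k
  have "(\<Sum>b\<in>supp \<phi>. coeff (Poly_Mapping.single b (coeff \<phi> b)) k)
      = (\<Sum>b\<in>supp \<phi>. if k = b then coeff \<phi> k else 0)"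
    by (rule sum.cong) (auto simp: lookup_single when_def)
  then show "coeff (\<Sum>b\<in>supp \<phi>. Poly_Mapping.single b (coeff \<phi> b)) k = coeff \<phi> k"
    by (simp add: lookup_sum in_keys_iff)
qed

lemma single_sum: "Poly_Mapping.single b (sum f A) = (\<Sum>a\<in>A. Poly_Mapping.single b (f a))"
  by (induction A rule: infinite_finite_induct) (auto simp: single_add)

lemma zero_in_term_span: "0 \<in> term_span T"
  by (simp add: term_span_def)

lemma term_span_add: "\<phi> \<in> term_span T \<Longrightarrow> \<psi> \<in> term_span T \<Longrightarrow> \<phi> + \<psi> \<in> term_span T"
  by (auto simp: term_span_def lookup_add dest!: supp_add_subset[THEN subsetD])

lemma term_span_uminus: "\<phi> \<in> term_span T \<Longrightarrow> - \<phi> \<in> term_span T"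
  by (simp add: term_span_def supp_minus)

lemma term_span_diff: "\<phi> \<in> term_span T \<Longrightarrow> \<psi> \<in> term_span T \<Longrightarrow> \<phi> - \<psi> \<in> term_span T"
  using term_span_add[OF _ term_span_uminus, of \<phi> T \<psi>] by simp

lemma term_span_sum: "(\<And>i. i \<in> I \<Longrightarrow> f i \<in> term_span T) \<Longrightarrow> sum f I \<in> term_span T"
  by (induction I rule: infinite_finite_induct) (auto intro: zero_in_term_span term_span_add)

lemma term_span_mono: "\<phi> \<in> term_span T \<Longrightarrow> T \<subseteq> T' \<Longrightarrow> \<phi> \<in> term_span T'"
  by (auto simp: term_span_def)

lemma term_span_eq_0:
  assumes "\<And>b t. (b, t) \<in> T \<Longrightarrow> coeff (coeff \<phi> b) t = 0" and "\<phi> \<in> term_span T"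
  shows "\<phi> = 0"
proof (intro poly_mapping_eqI)
  fix b t
  have "(b, t) \<in> T" if "t \<in> supp (coeff \<phi> b)"
    using assms(2) that by (simp add: term_span_def)
  then show "coeff (coeff \<phi> b) t = coeff (coeff 0 b) t"
    using assms(1)[of b t] by (auto simp: in_keys_iff)
qed

lemma coeff_fterm: "coeff (coeff (fterm b t c) b') t' = (if b = b' \<and> t = t' then c else 0)"
  by (auto simp: fterm_def lookup_single when_def)

lemma fterm_in_term_span: "(b, t) \<in> T \<Longrightarrow> fterm b t c \<in> term_span T"
  by (auto simp: term_span_def in_keys_iff coeff_fterm split: if_splits)

lemma fterm_0 [simp]: "fterm b t 0 = 0"
  by (simp add: fterm_def)

lemma fterm_uminus: "fterm b t (- c) = - fterm b t c"
  by (simp add: fterm_def single_uminus)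

lemma fterm_expansion:
  "\<phi> = (\<Sum>b\<in>supp \<phi>. \<Sum>t\<in>supp (coeff \<phi> b). fterm b t (coeff (coeff \<phi> b) t))"
  by (simp add: fterm_def single_sum[symmetric] poly_mapping_sum_single)

lemma term_span_induct [consumes 1, case_names zero add fterm]:
  assumes "\<phi> \<in> term_span T" and "P 0"
    and add: "\<And>\<phi> \<psi>. P \<phi> \<Longrightarrow> P \<psi> \<Longrightarrow> P (\<phi> + \<psi>)"
    and fterm: "\<And>b t c. (b, t) \<in> T \<Longrightarrow> P (fterm b t c)"
  shows "P \<phi>"
proof -
  have sum: "P (sum f I)" if "\<And>i. i \<in> I \<Longrightarrow> P (f i)" for f :: "'i \<Rightarrow> _" and I
    using that by (induction I rule: infinite_finite_induct) (auto intro: assms)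
  have "P (\<Sum>b\<in>supp \<phi>. \<Sum>t\<in>supp (coeff \<phi> b). fterm b t (coeff (coeff \<phi> b) t))"
    using \<open>\<phi> \<in> term_span T\<close> by (intro sum fterm) (auto simp: term_span_def)
  then show ?thesis by (simp only: fterm_expansion[symmetric])
qed

lemma sum_pairs_antisymmetric:
  fixes A :: "'i \<Rightarrow> 'i \<Rightarrow> 'm::ab_group_add"
  assumes "finite S" and "\<And>y z. y \<in> S \<Longrightarrow> z \<in> S \<Longrightarrow> y \<noteq> z \<Longrightarrow> A z y = - A y z"
  shows "(\<Sum>y\<in>S. \<Sum>z\<in>S - {y}. A y z) = 0"
  using assms
proof (induction S rule: finite_induct)
  case (insert u S)
  have S: "insert u S - {y} = insert u (S - {y})" if "y \<in> S" for y
    using that insert.hyps by auto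
  have "(\<Sum>z\<in>insert u S - {y}. A y z) = - A u y + (\<Sum>z\<in>S - {y}. A y z)" if "y \<in> S" for y
    unfolding S[OF that] using that insert.hyps insert.prems[of u y] by (subst sum.insert) auto
  then have "(\<Sum>y\<in>S. \<Sum>z\<in>insert u S - {y}. A y z) = (\<Sum>y\<in>S. - A u y + (\<Sum>z\<in>S - {y}. A y z))"
    by (rule sum.cong[OF refl])
  also have "\<dots> = - (\<Sum>y\<in>S. A u y) + (\<Sum>y\<in>S. \<Sum>z\<in>S - {y}. A y z)"
    by (simp only: sum.distrib sum_negf)
  also have "(\<Sum>y\<in>S. \<Sum>z\<in>S - {y}. A y z) = 0"
    by (intro insert.IH insert.prems insertI2)
  finally show ?case
    using insert.hyps by simp
qed simp

text \<open>The additive extension of a family of additive maps on the coordinates.\<close>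

definition coord_ext :: "('b \<Rightarrow> 'q::comm_monoid_add \<Rightarrow> 'm::comm_monoid_add) \<Rightarrow> ('b \<Rightarrow>\<^sub>0 'q) \<Rightarrow> 'm" where
  "coord_ext g \<phi> = (\<Sum>b\<in>supp \<phi>. g b (coeff \<phi> b))"

lemma coord_ext_superset:
  assumes "\<And>b. g b 0 = 0" and "finite A" and "supp \<phi> \<subseteq> A"
  shows "coord_ext g \<phi> = (\<Sum>b\<in>A. g b (coeff \<phi> b))"
  unfolding coord_ext_def using assms
  by (intro sum.mono_neutral_left) (auto simp: in_keys_iff)

lemma coord_ext_add:
  assumes "\<And>b. g b 0 = 0" and "\<And>b p q. g b (p + q) = g b p + g b q"
  shows "coord_ext g (\<phi> + \<psi>) = coord_ext g \<phi> + coord_ext g \<psi>"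
proof -
  let ?A = "supp \<phi> \<union> supp \<psi>"
  have "coord_ext g (\<phi> + \<psi>) = (\<Sum>b\<in>?A. g b (coeff (\<phi> + \<psi>) b))"
    by (intro coord_ext_superset assms) (auto dest: supp_add_subset[THEN subsetD])
  also have "\<dots> = (\<Sum>b\<in>?A. g b (coeff \<phi> b)) + (\<Sum>b\<in>?A. g b (coeff \<psi> b))"
    by (simp add: lookup_add assms sum.distrib)
  also have "\<dots> = coord_ext g \<phi> + coord_ext g \<psi>"
    by (intro arg_cong2[where f = "(+)"] coord_ext_superset[symmetric] assms) auto
  finally show ?thesis .
qed

lemma coord_ext_0 [simp]: "coord_ext g 0 = 0"
  by (simp add: coord_ext_def)

lemma coord_ext_single: "g b 0 = 0 \<Longrightarrow> coord_ext g (Poly_Mapping.single b q) = g b q"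
  by (simp add: coord_ext_def)

lemma coord_ext_fterm:
  assumes "\<And>b t. g b t 0 = 0"
  shows "coord_ext (\<lambda>b. coord_ext (g b)) (fterm b t c) = g b t c"
  by (simp add: fterm_def coord_ext_single assms)

lemma additive_0:
  fixes h :: "'a::ab_group_add \<Rightarrow> 'b::ab_group_add"
  shows "(\<And>x y. h (x + y) = h x + h y) \<Longrightarrow> h 0 = 0"
  by (metis add_cancel_right_right)

lemma additive_uminus:
  fixes h :: "'a::ab_group_add \<Rightarrow> 'b::ab_group_add"
  assumes "\<And>x y. h (x + y) = h x + h y"
  shows "h (- x) = - h x"
  using assms[of x "- x"] additive_0[of h, OF assms] by (metis add.right_inverse add_eq_0_iff)

lemma additive_diff:
  fixes h :: "'a::ab_group_add \<Rightarrow> 'b::ab_group_add"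
  assumes "\<And>x y. h (x + y) = h x + h y"
  shows "h (x - y) = h x - h y"
proof -
  have "h (x - y) = h (x + - y)" by simp
  also have "\<dots> = h x + h (- y)" by (rule assms)
  finally show ?thesis by (simp add: additive_uminus[of h, OF assms])
qed

lemma additive_sum:
  fixes h :: "'a::ab_group_add \<Rightarrow> 'b::ab_group_add"
  assumes "\<And>x y. h (x + y) = h x + h y"
  shows "h (sum f I) = (\<Sum>i\<in>I. h (f i))"
  by (induction I rule: infinite_finite_induct) (auto simp: assms additive_0[of h, OF assms])

lemma term_span_image:
  assumes "\<phi> \<in> term_span T" and add: "\<And>x y. h (x + y) = h x + h y"
    and "\<And>b t c. (b, t) \<in> T \<Longrightarrow> h (fterm b t c) \<in> term_span T'"
  shows "h \<phi> \<in> term_span T'"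
  using assms(1)
  by (induction rule: term_span_induct)
    (auto simp: assms additive_0[of h, OF add] intro: zero_in_term_span term_span_add)

text \<open>An additive map that sends the terms \<open>c t b\<close> with \<open>(b, t) \<in> T\<close> to multiples by \<open>c\<close> of pairwise
  distinct monomials forgets no coefficient; in particular, it is injective on the span of \<open>T\<close>.\<close>

lemma coeff_monomial_map:
  fixes h :: "('b, 'x, 'k::field) free_elem \<Rightarrow> ('x, 'k) mpoly"
  assumes "\<phi> \<in> term_span T" and add: "\<And>x y. h (x + y) = h x + h y"
    and h: "\<And>b t c. (b, t) \<in> T \<Longrightarrow> h (fterm b t c) = Poly_Mapping.single (e (b, t)) c"
    and inj: "inj_on e T"
  shows "\<forall>(b, t)\<in>T. coeff (h \<phi>) (e (b, t)) = coeff (coeff \<phi> b) t"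
  using assms(1)
proof (induction rule: term_span_induct)
  case zero
  then show ?case by (simp add: additive_0[of h, OF add])
next
  case (add \<phi> \<psi>)
  then show ?case by (fastforce simp: assms(2) lookup_add)
next
  case (fterm b t c)
  then show ?case using inj by (auto simp: h coeff_fterm lookup_single when_def dest: inj_onD)
qed

section \<open>Polynomial rings and free modules\<close>

lemma polys_in_iff: "p \<in> polys_in X \<longleftrightarrow> (\<forall>t\<in>supp p. supp t \<subseteq> X)"
  by (simp add: polys_in_def)

lemma polys_in_0 [simp]: "0 \<in> polys_in X" and polys_in_1 [simp]: "1 \<in> polys_in X"
  by (auto simp: polys_in_iff)

lemma polys_in_add: "p \<in> polys_in X \<Longrightarrow> q \<in> polys_in X \<Longrightarrow> p + q \<in> polys_in X"
  by (auto simp: polys_in_iff dest!: supp_add_subset[THEN subsetD])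

lemma polys_in_uminus: "p \<in> polys_in X \<Longrightarrow> - p \<in> polys_in X"
  by (simp add: polys_in_iff supp_minus)

lemma polys_in_mult:
  assumes "p \<in> polys_in X" and "q \<in> polys_in X"
  shows "p * q \<in> polys_in X"
proof (unfold polys_in_iff, intro ballI)
  fix t assume "t \<in> supp (p * q)"
  then obtain a b where "t = a + b" "a \<in> supp p" "b \<in> supp q"
    using keys_mult[of p q] by auto
  with assms show "supp t \<subseteq> X"
    by (fastforce simp: polys_in_iff dest: supp_add_subset[THEN subsetD])
qed

lemma polys_in_single: "supp t \<subseteq> X \<Longrightarrow> Poly_Mapping.single t c \<in> polys_in X"
  by (auto simp: polys_in_iff)

lemma poly_ring_simps [simp]:
  "carrier (poly_ring X) = polys_in X" "monoid.mult (poly_ring X) = (*)"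
  "one (poly_ring X) = 1" "zero (poly_ring X) = 0" "add (poly_ring X) = (+)"
  by (simp_all add: poly_ring_def)

lemma cring_poly_ring: "cring (poly_ring X)"
proof (rule cringI)
  show "abelian_group (poly_ring X)"
  proof (rule abelian_groupI, goal_cases)
    case (6 p)
    then show ?case by (auto intro: bexI[of _ "- p"] polys_in_uminus)
  qed (auto intro: polys_in_add simp: add_ac)
  show "comm_monoid (poly_ring X)"
    by (rule comm_monoidI) (auto intro: polys_in_mult simp: mult_ac)
qed (auto simp: algebra_simps)

lemma coeff_scale [simp]: "coeff (scale c \<phi>) b = c * coeff \<phi> b"
  by (simp add: scale_def Poly_Mapping.map.rep_eq when_def)

lemma scale_add_right: "scale c (\<phi> + \<psi>) = scale c \<phi> + scale c \<psi>"
  and scale_add_left: "scale (c + c') \<phi> = scale c \<phi> + scale c' \<phi>"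
  and scale_diff_right: "scale c (\<phi> - \<psi>) = scale c \<phi> - scale c \<psi>"
  and scale_scale: "scale c (scale c' \<phi>) = scale (c * c') \<phi>"
  by (auto intro!: poly_mapping_eqI simp: lookup_add lookup_minus algebra_simps)

lemma scale_0_left [simp]: "scale 0 \<phi> = 0" and scale_0_right [simp]: "scale c 0 = 0"
  and scale_1 [simp]: "scale 1 \<phi> = \<phi>"
  by (auto intro!: poly_mapping_eqI)

lemma scale_sum: "scale c (sum f A) = (\<Sum>a\<in>A. scale c (f a))"
  by (induction A rule: infinite_finite_induct) (auto simp: scale_add_right)

lemma scale_single: "scale c (Poly_Mapping.single b q) = Poly_Mapping.single b (c * q)"
  by (auto intro!: poly_mapping_eqI simp: lookup_single when_def)

lemma scale_fterm: "scale (Poly_Mapping.single u a) (fterm b t c) = fterm b (t + u) (a * c)"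
  by (simp add: fterm_def scale_single mult_single add.commute)

lemma carrier_free_module:
  "carrier (free_module X B) = term_span {(b, t). b \<in> B \<and> supp t \<subseteq> X}"
proof -
  have "supp \<phi> \<subseteq> B \<and> (\<forall>b. coeff \<phi> b \<in> polys_in X) \<longleftrightarrow>
      (\<forall>b. \<forall>t\<in>supp (coeff \<phi> b). b \<in> B \<and> supp t \<subseteq> X)" (is "?L \<longleftrightarrow> ?R")
    for \<phi> :: "('a, 'b, 'c) free_elem"
  proof
    assume ?L
    moreover have "b \<in> supp \<phi>" if "t \<in> supp (coeff \<phi> b)" for b t
      using that by (cases "b \<in> supp \<phi>") (simp_all add: in_keys_iff)
    ultimately show ?R unfolding polys_in_iff by blast
  next
    assume R: ?R
    have "b \<in> B" if "b \<in> supp \<phi>" for b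
    proof -
      have "supp (coeff \<phi> b) \<noteq> {}" using that by (simp add: in_keys_iff)
      with R show ?thesis by blast
    qed
    with R show ?L by (auto simp: polys_in_iff)
  qed
  then show ?thesis by (auto simp: free_module_def term_span_def)
qed

lemma free_module_simps [simp]:
  "zero (free_module X B) = 0" "add (free_module X B) = (+)" "smult (free_module X B) = scale"
  by (simp_all add: free_module_def)

lemma mem_free_module_iff:
  "\<phi> \<in> carrier (free_module X B) \<longleftrightarrow> supp \<phi> \<subseteq> B \<and> (\<forall>b. coeff \<phi> b \<in> polys_in X)"
  by (simp add: free_module_def)

lemma scale_in_free_module:
  assumes "c \<in> polys_in X" and "\<phi> \<in> carrier (free_module X B)"
  shows "scale c \<phi> \<in> carrier (free_module X B)"
proof -
  have "supp (scale c \<phi>) \<subseteq> supp \<phi>"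
    by (auto simp: in_keys_iff)
  then show ?thesis
    using assms by (auto simp: mem_free_module_iff intro: polys_in_mult)
qed

lemma abelian_group_free_module: "abelian_group (free_module X B)"
proof (rule abelian_groupI, goal_cases)
  case (6 p)
  then show ?case by (auto simp: carrier_free_module intro: bexI[of _ "- p"] term_span_uminus)
qed (auto intro: term_span_add zero_in_term_span simp: add_ac carrier_free_module)

lemma module_free_module: "module (poly_ring X) (free_module X B)"
  by (rule moduleI)
    (auto simp: cring_poly_ring abelian_group_free_module scale_in_free_module scale_add_left
      scale_add_right scale_scale)

lemma finsum_free_module:
  assumes "finite A" and "f \<in> A \<rightarrow> carrier (free_module X B)"
  shows "finsum (free_module X B) f A = sum f A"
  using assms
proof (induction A rule: finite_induct)
  interpret M: abelian_group "free_module X B" by (rule abelian_group_free_module)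
  case empty
  show ?case using M.finsum_empty by simp
next
  interpret M: abelian_group "free_module X B" by (rule abelian_group_free_module)
  case (insert a A)
  then show ?case by (subst M.finsum_insert) auto
qed

text \<open>The symbols form a basis: the coefficients of an element on them are its coordinates.\<close>

lemma module_basis_free_module:
  fixes B :: "'b set" and X :: "'x set"
  assumes "finite B"
  shows "module_basis (poly_ring X) (free_module X B :: (('x, 'k::field) mpoly, _) module)
    ((\<lambda>b. Poly_Mapping.single b 1) ` B)"
proof -
  let ?f = "\<lambda>b::'b. Poly_Mapping.single b (1 :: ('x, 'k) mpoly)"
  let ?M = "free_module X B :: (('x, 'k) mpoly, _) module"
  have inj: "inj_on ?f B"
  proof (rule inj_onI)
    fix b b' assume "?f b = ?f b'"
    then have "supp (?f b) = supp (?f b')" by simp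
    then show "b = b'" by simp
  qed
  have f: "?f b \<in> carrier ?M" if "b \<in> B" for b
    using that by (auto simp: mem_free_module_iff lookup_single when_def)
  have lin: "(\<Oplus>\<^bsub>?M\<^esub>e\<in>?f ` B. c e \<odot>\<^bsub>?M\<^esub> e) = (\<Sum>b\<in>B. Poly_Mapping.single b (c (?f b)))"
    if "c \<in> ?f ` B \<rightarrow>\<^sub>E carrier (poly_ring X)" for c
  proof -
    have "(\<Oplus>\<^bsub>?M\<^esub>e\<in>?f ` B. c e \<odot>\<^bsub>?M\<^esub> e) = (\<Sum>e\<in>?f ` B. scale (c e) e)"
      using assms that f by (subst finsum_free_module) (auto intro!: scale_in_free_module)
    also have "\<dots> = (\<Sum>b\<in>B. Poly_Mapping.single b (c (?f b)))"
      by (subst sum.reindex[OF inj]) (simp add: scale_single)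
    finally show ?thesis .
  qed
  have coeff: "coeff (\<Sum>b\<in>B. Poly_Mapping.single b (q b)) b' = (if b' \<in> B then q b' else 0)"
    for q :: "'b \<Rightarrow> ('x, 'k) mpoly" and b'
    using assms by (simp add: lookup_sum lookup_single when_def if_distrib cong: if_cong)
  show ?thesis
    unfolding module_basis_def
  proof (intro conjI ballI)
    show "finite (?f ` B)" using assms by simp
    show "?f ` B \<subseteq> carrier ?M" using f by blast
    fix \<phi> assume \<phi>: "\<phi> \<in> carrier ?M"
    let ?c = "restrict (\<lambda>e. coeff \<phi> (inv_into B ?f e)) (?f ` B)"
    have c: "?c \<in> ?f ` B \<rightarrow>\<^sub>E carrier (poly_ring X)"
      using \<phi> by (auto simp: mem_free_module_iff)
    have c_f: "?c (?f b) = coeff \<phi> b" if "b \<in> B" for b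
      using that inv_into_f_f[OF inj that] by simp
    show "\<exists>!c. c \<in> ?f ` B \<rightarrow>\<^sub>E carrier (poly_ring X) \<and> \<phi> = (\<Oplus>\<^bsub>?M\<^esub>e\<in>?f ` B. c e \<odot>\<^bsub>?M\<^esub> e)"
    proof (intro ex1I[of _ ?c] conjI c)
      have "coeff \<phi> b = coeff (\<Sum>b\<in>B. Poly_Mapping.single b (?c (?f b))) b" for b
        using \<phi> c_f[of b] unfolding coeff by (auto simp: mem_free_module_iff in_keys_iff)
      then show "\<phi> = (\<Oplus>\<^bsub>?M\<^esub>e\<in>?f ` B. ?c e \<odot>\<^bsub>?M\<^esub> e)"
        unfolding lin[OF c] by (rule poly_mapping_eqI)
    next
      fix c' assume c': "c' \<in> ?f ` B \<rightarrow>\<^sub>E carrier (poly_ring X) \<and> \<phi> = (\<Oplus>\<^bsub>?M\<^esub>e\<in>?f ` B. c' e \<odot>\<^bsub>?M\<^esub> e)"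
      then have eq: "\<phi> = (\<Sum>b\<in>B. Poly_Mapping.single b (c' (?f b)))"
        using lin[of c'] by simp
      have c'_f: "c' (?f b) = ?c (?f b)" if "b \<in> B" for b
        using coeff[of "\<lambda>b. c' (?f b)" b] that c_f[OF that] by (simp add: eq[symmetric])
      show "c' = ?c"
        by (rule PiE_ext[OF conjunct1[OF c'] c]) (use c'_f in blast)
    qed
  qed
qed

text \<open>The squarefree monomial with support \<open>C\<close>, for a finite set \<open>C\<close>.\<close>

definition set_monomial :: "'x set \<Rightarrow> 'x monomial" where
  "set_monomial C = (\<Sum>v\<in>C. Poly_Mapping.single v 1)"

lemma coeff_set_monomial: "finite C \<Longrightarrow> coeff (set_monomial C) v = (if v \<in> C then 1 else 0)"
  by (simp add: set_monomial_def lookup_sum lookup_single when_def if_distrib cong: if_cong)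

lemma supp_set_monomial: "finite C \<Longrightarrow> supp (set_monomial C) = C"
  by (auto simp: in_keys_iff coeff_set_monomial split: if_splits)

lemma sqfree_monom_eq: "sqfree_monom C = Poly_Mapping.single (set_monomial C) 1"
  unfolding sqfree_monom_def set_monomial_def var_def
  by (induction C rule: infinite_finite_induct) (auto simp: mult_single add.commute)

lemma sqfree_monom_in_polys: "finite C \<Longrightarrow> C \<subseteq> X \<Longrightarrow> sqfree_monom C \<in> polys_in X"
  by (simp add: sqfree_monom_eq polys_in_single supp_set_monomial)

lemma var_in_polys: "v \<in> X \<Longrightarrow> var v \<in> polys_in X"
  by (simp add: var_def polys_in_single)

lemma sqfree_monom_superset:
  assumes "finite C" and "D \<subseteq> C"
  shows "(sqfree_monom C :: ('x, 'k::field) mpoly) = sqfree_monom D * sqfree_monom (C - D)"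
  unfolding sqfree_monom_def using assms by (metis prod.subset_diff mult.commute)

lemma ideal_module_simps [simp]:
  "carrier (ideal_module J) = J" "zero (ideal_module J) = 0" "add (ideal_module J) = (+)"
  "smult (ideal_module J) = (*)"
  by (simp_all add: ideal_module_def)

lemma poly_ideal_closed:
  fixes J :: "('x, 'k::field) mpoly set"
  assumes "ideal J (poly_ring X)"
  shows "0 \<in> J" and "p \<in> J \<Longrightarrow> q \<in> J \<Longrightarrow> p + q \<in> J"
    and "p \<in> J \<Longrightarrow> - p \<in> J" and "p \<in> J \<Longrightarrow> c \<in> polys_in X \<Longrightarrow> c * p \<in> J"
    and "J \<subseteq> polys_in X"
proof -
  interpret ideal J "poly_ring X" by fact
  show "0 \<in> J" "p \<in> J \<Longrightarrow> q \<in> J \<Longrightarrow> p + q \<in> J" "J \<subseteq> polys_in X"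
    using additive_subgroup.zero_closed additive_subgroup.a_closed additive_subgroup.a_subset
      additive_subgroup_axioms by fastforce+
  show mult: "p \<in> J \<Longrightarrow> c \<in> polys_in X \<Longrightarrow> c * p \<in> J" for p c
    using I_l_closed[of p c] by simp
  show "p \<in> J \<Longrightarrow> - p \<in> J"
    using mult[of p "-1"] polys_in_uminus[OF polys_in_1, of X] by simp
qed

lemma module_ideal_module:
  assumes "ideal J (poly_ring X)"
  shows "module (poly_ring X) (ideal_module J)"
proof (rule moduleI[OF cring_poly_ring])
  note closed = poly_ideal_closed[OF assms]
  show "abelian_group (ideal_module J)"
  proof (rule abelian_groupI, goal_cases)
    case (6 p)
    then show ?case by (auto intro!: bexI[of _ "- p"] closed)
  qed (auto intro: closed simp: add_ac)
qed (auto intro: poly_ideal_closed[OF assms] simp: algebra_simps)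

lemma poly_idealI:
  fixes I :: "('x, 'k::field) mpoly set"
  assumes "I \<subseteq> polys_in X" and "0 \<in> I" and "\<And>p q. p \<in> I \<Longrightarrow> q \<in> I \<Longrightarrow> p + q \<in> I"
    and mult: "\<And>c p. c \<in> polys_in X \<Longrightarrow> p \<in> I \<Longrightarrow> c * p \<in> I"
  shows "ideal I (poly_ring X)"
proof -
  interpret cring "poly_ring X :: ('x, 'k) mpoly ring" by (rule cring_poly_ring)
  have minus: "\<ominus>\<^bsub>poly_ring X\<^esub> p = - p" if "p \<in> polys_in X" for p :: "('x, 'k) mpoly"
    using that by (intro minus_equality) (auto intro: polys_in_uminus)
  show ?thesis
  proof (rule idealI[OF ring_axioms])
    show "subgroup I (add_monoid (poly_ring X))"
    proof (rule add.subgroupI)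
      fix p assume "p \<in> I"
      then have "- p \<in> I"
        using mult[of "-1" p] polys_in_uminus[OF polys_in_1, of X] by simp
      then show "\<ominus>\<^bsub>poly_ring X\<^esub> p \<in> I"
        using \<open>p \<in> I\<close> assms(1) minus by auto
    qed (use assms in auto)
    fix p c :: "('x, 'k) mpoly" assume p: "p \<in> I" "c \<in> carrier (poly_ring X)"
    then show "c \<otimes>\<^bsub>poly_ring X\<^esub> p \<in> I" by (simp add: mult)
    then show "p \<otimes>\<^bsub>poly_ring X\<^esub> c \<in> I" by (simp add: mult.commute)
  qed
qed

lemma coord_ext_scale:
  fixes g :: "'b \<Rightarrow> ('x, 'k::field) mpoly \<Rightarrow> 'm::comm_monoid_add"
  assumes "\<And>b. g b 0 = 0" and "\<And>b p. g b (c * p) = act (g b p)"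
    and "\<And>y z. act (y + z) = act y + act z" and "act 0 = 0"
  shows "coord_ext g (scale c \<phi>) = act (coord_ext g \<phi>)"
proof -
  have act_sum: "act (sum f A) = (\<Sum>a\<in>A. act (f a))" for f :: "'b \<Rightarrow> _" and A
    by (induction A rule: infinite_finite_induct) (auto simp: assms)
  have "coord_ext g (scale c \<phi>) = (\<Sum>b\<in>supp \<phi>. g b (coeff (scale c \<phi>) b))"
    by (rule coord_ext_superset) (auto simp: assms in_keys_iff)
  also have "\<dots> = act (coord_ext g \<phi>)"
    by (simp add: assms(2) act_sum coord_ext_def)
  finally show ?thesis .
qed

lemma free_component_eq:
  "free_component X B deg m = term_span {(b, t). b \<in> B \<and> supp t \<subseteq> X \<and> t + deg b = m}"
  unfolding free_component_def carrier_free_module term_span_def by auto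

text \<open>The product of the irrelevant ideal with a free module contains every term other than the
  scalar multiples of the symbols.\<close>

lemma term_span_subset_irrelevant_smult:
  fixes B :: "'b set" and X :: "'x set" and \<phi> :: "('b, 'x, 'k::field) free_elem"
  assumes "\<phi> \<in> term_span {(b, t). b \<in> B \<and> supp t \<subseteq> X \<and> t \<noteq> 0}"
  shows "\<phi> \<in> ideal_smult (poly_ring X) (irrelevant_ideal X) (free_module X B)"
  unfolding ideal_smult_def
proof clarify
  fix H :: "('b, 'x, 'k) free_elem set"
  assume "submodule H (poly_ring X) (free_module X B)"
    and H: "\<forall>a\<in>irrelevant_ideal X. \<forall>x\<in>carrier (free_module X B). a \<odot>\<^bsub>free_module X B\<^esub> x \<in> H"
  interpret submodule H "poly_ring X" "free_module X B" by fact
  interpret R: cring "poly_ring X :: ('x, 'k) mpoly ring" by (rule cring_poly_ring)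
  have var: "(var v :: ('x, 'k) mpoly) \<in> irrelevant_ideal X" if "v \<in> X" for v
  proof -
    have "var ` X \<subseteq> carrier (poly_ring X :: ('x, 'k) mpoly ring)"
      by (auto simp: var_in_polys)
    from R.genideal_self[OF this] show ?thesis
      using that by (auto simp: irrelevant_ideal_def)
  qed
  show "\<phi> \<in> H"
    using assms
  proof (induction rule: term_span_induct)
    case zero
    show ?case using one_closed by simp
  next
    case (add \<phi> \<psi>)
    then show ?case using m_closed by simp
  next
    case (fterm b t c)
    then obtain v where v: "coeff t v \<noteq> 0" "v \<in> X" "b \<in> B" "supp t \<subseteq> X"
      by (auto simp: poly_mapping_eq_iff fun_eq_iff in_keys_iff subset_iff)
    define u where "u = t - Poly_Mapping.single v 1"
    have t: "t = u + Poly_Mapping.single v 1"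
      using v by (auto intro!: poly_mapping_eqI simp: u_def lookup_add lookup_minus lookup_single when_def)
    have "supp u \<subseteq> X"
      using v by (auto simp: u_def in_keys_iff lookup_minus)
    then have "fterm b u c \<in> carrier (free_module X B)"
      using v by (auto simp: carrier_free_module intro: fterm_in_term_span)
    then have "scale (var v) (fterm b u c) \<in> H"
      using H var[OF \<open>v \<in> X\<close>] by simp
    then show ?case by (simp add: var_def scale_fterm t)
  qed
qed

section \<open>Minimal vertex covers of the whiskered graph\<close>

lemma vertex_cover_contains_min:
  assumes "finite C" and "vertex_cover V E C"
  shows "\<exists>D\<subseteq>C. min_vertex_cover V E D"
  using assms
proof (induction C rule: finite_psubset_induct)
  case (psubset C)
  show ?case
  proof (cases "min_vertex_cover V E C")
    case False
    then obtain D where D: "D \<subset> C" "vertex_cover V E D"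
      using psubset.prems unfolding min_vertex_cover_def by metis
    obtain D' where "D' \<subseteq> D" "min_vertex_cover V E D'"
      using psubset.IH[OF D] by metis
    then show ?thesis using D(1) by (intro exI[of _ D']) auto
  qed (intro exI[of _ C], auto)
qed

text \<open>The vertices \<open>x a b\<close> are those of \<open>W a\<close>, and each clique has at least one whisker.\<close>

locale whiskered_clique_partition =
  fixes V :: "'v set" and E :: "'v set set" and r :: nat and W :: "nat \<Rightarrow> 'v set"
    and x :: "nat \<Rightarrow> nat \<Rightarrow> 'v" and n :: "nat \<Rightarrow> nat"
  assumes graph: "simple_graph V E"
    and partition: "clique_partition V E r W"
    and labelling: "\<forall>a\<in>{1..r}. bij_betw (x a) {1..card (W a)} (W a)"
    and whiskers: "\<forall>a\<in>{1..r}. n a > 0"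
begin

abbreviation VG :: "'v wvertex set" where "VG \<equiv> whiskered_vertices V r n"
abbreviation EG :: "'v wvertex set set" where "EG \<equiv> whiskered_edges E r W n"
abbreviation symbs :: "nat \<Rightarrow> 'v symb set" where "symbs \<equiv> symbols V E r W n"

text \<open>The label of a vertex: \<open>label (x a b) = (a, b)\<close>.\<close>

definition label :: "'v \<Rightarrow> nat \<times> nat" where
  "label = inv_into (vertex_indices r W) (\<lambda>(a, b). x a b)"

abbreviation part :: "'v \<Rightarrow> nat" where "part y \<equiv> fst (label y)"

text \<open>The strict order on the vertices. All that matters about it is that of two distinct vertices
  exactly one precedes the other.\<close>

definition precedes :: "'v \<Rightarrow> 'v \<Rightarrow> bool" where
  "precedes y z \<longleftrightarrow> part y < part z \<or> part y = part z \<and> snd (label y) < snd (label z)"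

text \<open>The whiskers at the clique of a vertex.\<close>

definition block :: "'v \<Rightarrow> 'v wvertex set" where
  "block y = whisker_block n (part y)"

text \<open>The exchange of the whiskers at the clique of \<open>y\<close> for \<open>y\<close>. It deletes \<open>y\<close> from the independent
  set that belongs to a minimal vertex cover (\<open>min_vertex_cover_move\<close>).\<close>

definition move :: "'v \<Rightarrow> 'v wvertex set \<Rightarrow> 'v wvertex set" where
  "move y C = (C - block y) \<union> {Old y}"

lemma finite_V: "finite V"
  using graph by (simp add: simple_graph_def)

lemma finite_VG: "finite VG"
proof -
  have "finite (whisker_block n a :: 'v wvertex set)" for a
    unfolding whisker_block_def by simp
  then show ?thesis by (simp add: whiskered_vertices_def finite_V)
qed

lemma W_subset: "a \<in> {1..r} \<Longrightarrow> W a \<subseteq> V"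
  using partition by (auto simp: clique_partition_def)

lemma bij_vertex_indices: "bij_betw (\<lambda>(a, b). x a b) (vertex_indices r W) V"
proof -
  have image: "x a ` {1..card (W a)} = W a" and inj: "inj_on (x a) {1..card (W a)}"
    if "a \<in> {1..r}" for a
    using labelling that by (auto simp: bij_betw_def)
  have "inj_on (\<lambda>(a, b). x a b) (vertex_indices r W)"
  proof (rule inj_onI, clarify)
    fix a b a' b'
    assume ab: "(a, b) \<in> vertex_indices r W" "(a', b') \<in> vertex_indices r W" and eq: "x a b = x a' b'"
    then have a: "a \<in> {1..r}" "b \<in> {1..card (W a)}" "a' \<in> {1..r}" "b' \<in> {1..card (W a')}"
      by (auto simp: vertex_indices_def)
    have "x a b \<in> W a" "x a' b' \<in> W a'"
      using image[OF a(1)] image[OF a(3)] a by blast+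
    then have "a = a'"
      using eq a partition unfolding clique_partition_def disjoint_family_on_def by (metis disjoint_iff)
    then show "a = a' \<and> b = b'"
      using inj_onD[OF inj[OF a(1)], of b b'] eq a by simp
  qed
  moreover have "(\<lambda>(a, b). x a b) ` vertex_indices r W = (\<Union>a\<in>{1..r}. x a ` {1..card (W a)})"
  proof (intro subset_antisym subsetI)
    fix y assume "y \<in> (\<lambda>(a, b). x a b) ` vertex_indices r W"
    then obtain a b where y: "y = x a b" and "(a, b) \<in> vertex_indices r W" by auto
    then have "a \<in> {1..r}" "b \<in> {1..card (W a)}" by (simp_all add: vertex_indices_def)
    then show "y \<in> (\<Union>a\<in>{1..r}. x a ` {1..card (W a)})"
      unfolding y by (intro UN_I[of a] image_eqI[where x = b] refl)
  next
    fix y assume "y \<in> (\<Union>a\<in>{1..r}. x a ` {1..card (W a)})"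
    then obtain a b where y: "y = x a b" and "a \<in> {1..r}" "b \<in> {1..card (W a)}" by blast
    then have "(a, b) \<in> vertex_indices r W" by (simp add: vertex_indices_def)
    then show "y \<in> (\<lambda>(a, b). x a b) ` vertex_indices r W"
      by (rule rev_image_eqI) (simp add: y)
  qed
  then have "(\<lambda>(a, b). x a b) ` vertex_indices r W = V"
    using image partition by (simp add: clique_partition_def)
  ultimately show ?thesis by (simp add: bij_betw_def)
qed

lemma label_x: "(a, b) \<in> vertex_indices r W \<Longrightarrow> label (x a b) = (a, b)"
  using bij_vertex_indices inv_into_f_f[of "\<lambda>(a, b). x a b" "vertex_indices r W" "(a, b)"]
  by (simp add: label_def bij_betw_def)

lemma label_mem: "y \<in> V \<Longrightarrow> label y \<in> vertex_indices r W"
  and x_label: "y \<in> V \<Longrightarrow> x (part y) (snd (label y)) = y"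
  using bij_vertex_indices inv_into_into[of y "\<lambda>(a, b). x a b" "vertex_indices r W"]
    f_inv_into_f[of y "\<lambda>(a, b). x a b" "vertex_indices r W"]
  by (auto simp: label_def bij_betw_def split: prod.splits)

lemma part_bounds: "y \<in> V \<Longrightarrow> part y \<in> {1..r}"
  using label_mem[of y] by (auto simp: vertex_indices_def split: prod.splits)

lemma mem_part: "y \<in> V \<Longrightarrow> y \<in> W (part y)"
proof -
  assume y: "y \<in> V"
  then have "snd (label y) \<in> {1..card (W (part y))}" "x (part y) ` {1..card (W (part y))} = W (part y)"
    using label_mem[of y] labelling part_bounds[of y]
    by (auto simp: vertex_indices_def bij_betw_def split: prod.splits)
  then show ?thesis using x_label[OF y] by (metis imageI)
qed

lemma part_unique: "y \<in> W a \<Longrightarrow> a \<in> {1..r} \<Longrightarrow> part y = a"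
  using mem_part[of y] part_bounds[of y] W_subset[of a] partition
  unfolding clique_partition_def disjoint_family_on_def by blast

lemma precedes_iff_not:
  assumes "y \<in> V" and "z \<in> V" and "y \<noteq> z"
  shows "precedes y z \<longleftrightarrow> \<not> precedes z y"
proof -
  have "label y \<noteq> label z" using x_label assms by metis
  then show ?thesis by (auto simp: precedes_def prod_eq_iff)
qed

lemma clique_edge: "a \<in> {1..r} \<Longrightarrow> u \<in> W a \<Longrightarrow> v \<in> W a \<Longrightarrow> u \<noteq> v \<Longrightarrow> {u, v} \<in> E"
  using partition by (auto simp: clique_partition_def clique_def)

text \<open>The minimal vertex covers are determined by the independent sets of the graph: the vertices of
  the graph that are not in the cover form an independent set, and a whisker is in the cover
  precisely when its clique meets that set.\<close>

lemma min_vertex_cover_iff: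
  "min_vertex_cover VG EG C \<longleftrightarrow> C \<subseteq> VG \<and> (\<forall>e\<in>E. \<exists>v\<in>e. Old v \<in> C) \<and>
     (\<forall>a\<in>{1..r}. \<forall>k\<in>{1..n a}. Whisker a k \<in> C \<longleftrightarrow> (\<exists>v\<in>W a. Old v \<notin> C))"
proof -
  have cover: "vertex_cover VG EG D \<longleftrightarrow> D \<subseteq> VG \<and> (\<forall>e\<in>E. \<exists>v\<in>e. Old v \<in> D) \<and>
      (\<forall>a\<in>{1..r}. \<forall>k\<in>{1..n a}. \<forall>v\<in>W a. Old v \<in> D \<or> Whisker a k \<in> D)" for D
  proof -
    have old: "Old ` e \<inter> D \<noteq> {} \<longleftrightarrow> (\<exists>v\<in>e. Old v \<in> D)" for e by auto
    have whisker: "(\<forall>e\<in>{{Old v, w} |v w. v \<in> W a \<and> w \<in> whisker_block n a}. e \<inter> D \<noteq> {}) \<longleftrightarrow>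
        (\<forall>k\<in>{1..n a}. \<forall>v\<in>W a. Old v \<in> D \<or> Whisker a k \<in> D)" (is "?l \<longleftrightarrow> ?r") for a
    proof (intro iffI ballI)
      fix k v assume l: ?l and "k \<in> {1..n a}" "v \<in> W a"
      then have "Whisker a k \<in> whisker_block n a" by (simp add: whisker_block_def)
      with \<open>v \<in> W a\<close> have "{Old v, Whisker a k} \<in> {{Old v, w} |v w. v \<in> W a \<and> w \<in> whisker_block n a}"
        by (intro CollectI exI[of _ v] exI[of _ "Whisker a k"]) simp
      with l have "{Old v, Whisker a k} \<inter> D \<noteq> {}" by (rule bspec)
      then show "Old v \<in> D \<or> Whisker a k \<in> D" by auto
    next
      fix e assume ?r and "e \<in> {{Old v, w} |v w. v \<in> W a \<and> w \<in> whisker_block n a}"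
      then obtain v k where "e = {Old v, Whisker a k}" "Old v \<in> D \<or> Whisker a k \<in> D"
        unfolding whisker_block_def by auto
      then show "e \<inter> D \<noteq> {}" by auto
    qed
    have image: "(\<forall>e\<in>(\<lambda>e. Old ` e) ` E. P e) \<longleftrightarrow> (\<forall>e\<in>E. P (Old ` e))" for P by simp
    show ?thesis
      by (simp only: vertex_cover_def whiskered_edges_def ball_Un ball_UN image old whisker)
  qed
  show ?thesis
  proof
    assume min: "min_vertex_cover VG EG C"
    then have C: "vertex_cover VG EG C" by (simp add: min_vertex_cover_def)
    have "\<exists>v\<in>W a. Old v \<notin> C" if "Whisker a k \<in> C" "a \<in> {1..r}" for a k
    proof (rule ccontr)
      assume "\<not> (\<exists>v\<in>W a. Old v \<notin> C)"
      then have "vertex_cover VG EG (C - {Whisker a k})"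
        using C unfolding cover by auto
      then show False using min that by (auto simp: min_vertex_cover_def)
    qed
    moreover have "Whisker a k \<in> C" if "v \<in> W a" "Old v \<notin> C" "a \<in> {1..r}" "k \<in> {1..n a}" for a k v
      using C that unfolding cover by metis
    ultimately have "Whisker a k \<in> C \<longleftrightarrow> (\<exists>v\<in>W a. Old v \<notin> C)"
      if "a \<in> {1..r}" "k \<in> {1..n a}" for a k
      using that by metis
    then show "C \<subseteq> VG \<and> (\<forall>e\<in>E. \<exists>v\<in>e. Old v \<in> C) \<and>
      (\<forall>a\<in>{1..r}. \<forall>k\<in>{1..n a}. Whisker a k \<in> C \<longleftrightarrow> (\<exists>v\<in>W a. Old v \<notin> C))"
      using C unfolding cover by simp
  next
    assume C: "C \<subseteq> VG \<and> (\<forall>e\<in>E. \<exists>v\<in>e. Old v \<in> C) \<and>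
      (\<forall>a\<in>{1..r}. \<forall>k\<in>{1..n a}. Whisker a k \<in> C \<longleftrightarrow> (\<exists>v\<in>W a. Old v \<notin> C))"
    then have wh: "Whisker a k \<in> C \<longleftrightarrow> (\<exists>v\<in>W a. Old v \<notin> C)" if "a \<in> {1..r}" "k \<in> {1..n a}" for a k
      using that by simp
    have "\<not> vertex_cover VG EG D" if "D \<subset> C" for D
    proof
      assume D: "vertex_cover VG EG D"
      have D_wh: "Old v \<in> D \<or> Whisker a k \<in> D" if "a \<in> {1..r}" "k \<in> {1..n a}" "v \<in> W a" for a k v
        using D that unfolding cover by metis
      obtain c where c: "c \<in> C" "c \<notin> D" using \<open>D \<subset> C\<close> by blast
      then have "c \<in> VG" using C by auto
      show False
      proof (cases c)
        case (Whisker a k)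
        then have ak: "a \<in> {1..r}" "k \<in> {1..n a}"
          using \<open>c \<in> VG\<close> by (auto simp: whiskered_vertices_def whisker_block_def)
        then obtain v where "v \<in> W a" "Old v \<notin> C" using wh c Whisker by blast
        then show False using D_wh[OF ak, of v] c Whisker \<open>D \<subset> C\<close> by (metis psubsetD)
      next
        case (Old v)
        then have v: "v \<in> V" using \<open>c \<in> VG\<close> by (auto simp: whiskered_vertices_def whisker_block_def)
        note a = part_bounds[OF v]
        show False
        proof (cases "\<exists>u\<in>W (part v). Old u \<notin> C")
          case True
          then obtain u where u: "u \<in> W (part v)" "Old u \<notin> C" by blast
          then have "{u, v} \<in> E"
            using clique_edge[OF a u(1) mem_part[OF v]] c Old by metis
          moreover have "\<forall>e\<in>E. \<exists>v\<in>e. Old v \<in> D" using D unfolding cover by simp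
          ultimately have "\<exists>w\<in>{u, v}. Old w \<in> D" by (rule bspec[rotated])
          then have "Old u \<in> D \<or> Old v \<in> D" by simp
          then show False using u c Old \<open>D \<subset> C\<close> by (metis psubsetD)
        next
          case False
          \<comment> \<open>The clique of \<open>v\<close> has at least one whisker, and none of them is in \<open>C\<close>.\<close>
          have "1 \<in> {1..n (part v)}" using whiskers a by (auto simp: Suc_le_eq)
          then show False
            using False wh[OF a] D_wh[OF a _ mem_part[OF v]] c Old \<open>D \<subset> C\<close> by (metis psubsetD)
        qed
      qed
    qed
    moreover have "vertex_cover VG EG C"
      unfolding cover using C by auto
    ultimately show "min_vertex_cover VG EG C" by (simp add: min_vertex_cover_def)
  qed
qed

lemma block_eq: "block y = {Whisker (part y) k |k. k \<in> {1..n (part y)}}"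
  by (simp add: block_def whisker_block_def)

lemma finite_block: "finite (block y)"
  by (simp add: block_eq)

lemma block_subset_VG: "y \<in> V \<Longrightarrow> block y \<subseteq> VG"
  using part_bounds by (auto simp: whiskered_vertices_def block_def)

lemma block_nonempty: "y \<in> V \<Longrightarrow> block y \<noteq> {}"
proof -
  assume "y \<in> V"
  then have "Whisker (part y) 1 \<in> block y"
    using whiskers part_bounds[of y] by (auto simp: block_eq Suc_le_eq)
  then show ?thesis by blast
qed

lemma Old_in_VG: "Old y \<in> VG \<longleftrightarrow> y \<in> V"
  by (auto simp: whiskered_vertices_def whisker_block_def)

lemma Old_in_move: "Old z \<in> move y C \<longleftrightarrow> z = y \<or> Old z \<in> C"
  by (auto simp: move_def block_eq)

lemma move_commute: "move z (move y C) = move y (move z C)"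
  by (auto simp: move_def block_eq)

lemma block_subset_cover:
  assumes "min_vertex_cover VG EG C" and "y \<in> V" and "Old y \<notin> C"
  shows "block y \<subseteq> C"
  using assms mem_part[of y] part_bounds[of y] by (auto simp: block_eq min_vertex_cover_iff)

lemma min_vertex_cover_move:
  assumes C: "min_vertex_cover VG EG C" and y: "y \<in> V" "Old y \<notin> C"
  shows "min_vertex_cover VG EG (move y C)"
  unfolding min_vertex_cover_iff
proof (intro conjI ballI)
  show "move y C \<subseteq> VG"
    using C y by (auto simp: min_vertex_cover_iff move_def Old_in_VG)
  show "\<exists>v\<in>e. Old v \<in> move y C" if "e \<in> E" for e
  proof -
    have "\<exists>v\<in>e. Old v \<in> C" using C that unfolding min_vertex_cover_iff by simp
    then show ?thesis by (auto simp: Old_in_move)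
  qed
  fix a k assume ak: "a \<in> {1..r}" "k \<in> {1..n a}"
  show "Whisker a k \<in> move y C \<longleftrightarrow> (\<exists>v\<in>W a. Old v \<notin> move y C)"
  proof (cases "a = part y")
    case True
    \<comment> \<open>\<open>y\<close> is the only vertex of its clique outside \<open>C\<close>.\<close>
    have "Old v \<in> C" if "v \<in> W a" "v \<noteq> y" for v
    proof -
      have "{v, y} \<in> E" using clique_edge[OF ak(1), of v y] that mem_part[OF y(1)] True by metis
      then have "\<exists>w\<in>{v, y}. Old w \<in> C" using C unfolding min_vertex_cover_iff by metis
      then show ?thesis using y(2) by simp
    qed
    then show ?thesis
      using ak True by (auto simp: Old_in_move) (auto simp: move_def block_eq)
  next
    case False
    then have "y \<notin> W a" using part_unique ak by blast
    then have "(\<exists>v\<in>W a. Old v \<notin> move y C) \<longleftrightarrow> (\<exists>v\<in>W a. Old v \<notin> C)"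
      by (auto simp: Old_in_move)
    moreover have "Whisker a k \<in> move y C \<longleftrightarrow> Whisker a k \<in> C"
      using False by (auto simp: move_def block_eq)
    ultimately show ?thesis using C ak by (simp add: min_vertex_cover_iff)
  qed
qed

lemma min_vertex_cover_eqI:
  assumes C: "min_vertex_cover VG EG C" and D: "min_vertex_cover VG EG D"
    and eq: "\<And>v. v \<in> V \<Longrightarrow> Old v \<in> C \<longleftrightarrow> Old v \<in> D"
  shows "C = D"
proof (rule Set.set_eqI)
  fix c
  show "c \<in> C \<longleftrightarrow> c \<in> D"
  proof (cases "c \<in> VG")
    case True
    then consider v where "c = Old v" "v \<in> V" | a k where "c = Whisker a k" "a \<in> {1..r}" "k \<in> {1..n a}"
      by (auto simp: whiskered_vertices_def whisker_block_def)
    then show ?thesis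
    proof cases
      case 1
      then show ?thesis using eq by simp
    next
      case (2 a k)
      have "(\<exists>v\<in>W a. Old v \<notin> C) \<longleftrightarrow> (\<exists>v\<in>W a. Old v \<notin> D)"
        using eq W_subset[OF 2(2)] by blast
      then show ?thesis using C D 2 by (simp add: min_vertex_cover_iff)
    qed
  qed (use C D in \<open>auto simp: min_vertex_cover_iff\<close>)
qed

lemma mem_symbols_iff:
  "(C, \<sigma>) \<in> symbs p \<longleftrightarrow>
     min_vertex_cover VG EG C \<and> \<sigma> \<subseteq> V \<and> (\<forall>y\<in>\<sigma>. Old y \<notin> C) \<and> card \<sigma> = p"
  by (auto simp: symbols_def)

lemma finite_symbols: "finite (symbs p)"
proof (rule finite_subset)
  show "symbs p \<subseteq> Pow VG \<times> Pow V"
    by (auto simp: symbols_def min_vertex_cover_def vertex_cover_def)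
qed (simp add: finite_V finite_VG)

lemma symbol_delete:
  assumes "(C, \<sigma>) \<in> symbs p" and "y \<in> \<sigma>"
  shows "(C, \<sigma> - {y}) \<in> symbs (p - 1)" and "(move y C, \<sigma> - {y}) \<in> symbs (p - 1)"
proof -
  have "finite \<sigma>" using assms finite_subset[OF _ finite_V] by (auto simp: mem_symbols_iff)
  then show "(C, \<sigma> - {y}) \<in> symbs (p - 1)"
    using assms by (auto simp: mem_symbols_iff)
  show "(move y C, \<sigma> - {y}) \<in> symbs (p - 1)"
    using assms \<open>finite \<sigma>\<close> min_vertex_cover_move[of C y] by (auto simp: mem_symbols_iff Old_in_move)
qed

section \<open>The differential on terms\<close>

abbreviation x_mon :: "'v \<Rightarrow> 'v wvertex monomial" where
  "x_mon y \<equiv> Poly_Mapping.single (Old y) 1"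

abbreviation w_mon :: "'v \<Rightarrow> 'v wvertex monomial" where
  "w_mon y \<equiv> set_monomial (block y)"

abbreviation boundary :: "('v symb, 'v wvertex, 'k::field) free_elem \<Rightarrow> ('v symb, 'v wvertex, 'k) free_elem"
  where "boundary \<equiv> differential r W n x"

text \<open>The sign of deleting \<open>y\<close> from \<open>\<sigma>\<close>, as a scalar.\<close>

definition deletion_sign :: "'v set \<Rightarrow> 'v \<Rightarrow> 'k::field" where
  "deletion_sign \<sigma> y = (-1) ^ card {z \<in> \<sigma>. precedes y z}"

lemma deletion_sign_square: "deletion_sign \<sigma> y * deletion_sign \<sigma> y = (1::'k::field)"
  by (simp add: deletion_sign_def power_mult_distrib[symmetric])

lemma deletion_sign_remove:
  assumes "finite \<sigma>" and "z \<in> \<sigma>"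
  shows "deletion_sign \<sigma> y = (if precedes y z then - 1 else 1 :: 'k::field) * deletion_sign (\<sigma> - {z}) y"
proof -
  have "{u \<in> \<sigma>. precedes y u} =
      (if precedes y z then insert z {u \<in> \<sigma> - {z}. precedes y u} else {u \<in> \<sigma> - {z}. precedes y u})"
    using assms(2) by auto
  then show ?thesis using assms(1) by (simp add: deletion_sign_def)
qed

lemma deletion_sign_anticommute:
  assumes "\<sigma> \<subseteq> V" and "y \<in> \<sigma>" and "z \<in> \<sigma>" and "y \<noteq> z"
  shows "deletion_sign \<sigma> y * deletion_sign (\<sigma> - {y}) z
    = - (deletion_sign \<sigma> z * deletion_sign (\<sigma> - {z}) y :: 'k::field)"
proof -
  have "finite \<sigma>" using assms(1) finite_V by (rule finite_subset)
  moreover have "precedes y z \<longleftrightarrow> \<not> precedes z y" using assms by (intro precedes_iff_not) auto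
  ultimately show ?thesis
    using deletion_sign_remove[of \<sigma> z y, where 'k = 'k] deletion_sign_remove[of \<sigma> y z, where 'k = 'k] assms
    by simp
qed

lemma deletion_sign_insert:
  assumes "insert v \<sigma> \<subseteq> V" and "y \<in> \<sigma>" and "v \<notin> \<sigma>"
  shows "deletion_sign (insert v \<sigma>) v * deletion_sign (insert v \<sigma>) y
    = - (deletion_sign (insert v (\<sigma> - {y})) v * deletion_sign \<sigma> y :: 'k::field)"
proof -
  have "finite (insert v \<sigma>)" using assms(1) finite_V by (rule finite_subset)
  moreover have "precedes y v \<longleftrightarrow> \<not> precedes v y" using assms by (intro precedes_iff_not) auto
  moreover have "insert v \<sigma> - {v} = \<sigma>" "insert v \<sigma> - {y} = insert v (\<sigma> - {y})" using assms by auto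
  ultimately show ?thesis
    using deletion_sign_remove[of "insert v \<sigma>" v y, where 'k = 'k]
      deletion_sign_remove[of "insert v \<sigma>" y v, where 'k = 'k] assms
    by simp
qed

lemma sign_exponent_eq:
  assumes "\<sigma> \<subseteq> V" and "y \<in> V"
  shows "sign_exponent r W x \<sigma> (part y) (snd (label y)) = card {z \<in> \<sigma>. precedes y z}"
proof -
  have "{x s t |s t. (s, t) \<in> vertex_indices r W \<and> x s t \<in> \<sigma> \<and>
      (part y < s \<or> part y = s \<and> snd (label y) < t)} = {z \<in> \<sigma>. precedes y z}" (is "?L = ?R")
  proof
    show "?L \<subseteq> ?R" by (auto simp: precedes_def label_x)
    show "?R \<subseteq> ?L"
    proof
      fix z assume z: "z \<in> ?R"
      then have zV: "z \<in> V" using assms by auto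
      show "z \<in> ?L"
        using z label_mem[OF zV] x_label[OF zV]
        by (intro CollectI exI[of _ "part z"] exI[of _ "snd (label z)"]) (auto simp: precedes_def)
    qed
  qed
  then show ?thesis by (simp add: sign_exponent_def)
qed

lemma symbol_boundary_eq:
  assumes "\<sigma> \<subseteq> V"
  shows "(symbol_boundary r W n x C \<sigma> :: ('v symb, 'v wvertex, 'k::field) free_elem) =
    (\<Sum>y\<in>\<sigma>. fterm (move y C, \<sigma> - {y}) (w_mon y) (deletion_sign \<sigma> y)
      - fterm (C, \<sigma> - {y}) (x_mon y) (deletion_sign \<sigma> y))"
  unfolding symbol_boundary_def
proof (rule sum.reindex_bij_witness[of _ label "\<lambda>(a, b). x a b"], goal_cases)
  case (5 ab)
  then obtain a b where ab: "ab = (a, b)" "(a, b) \<in> vertex_indices r W" "x a b \<in> \<sigma>" by auto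
  define y where "y = x a b"
  have y: "label y = (a, b)" "y \<in> \<sigma>" "y \<in> V"
    using ab assms label_x by (auto simp: y_def)
  have sign: "(-1 :: ('v wvertex, 'k) mpoly) ^ k = Poly_Mapping.single 0 ((-1) ^ k)" for k
    by (induction k) (simp_all add: single_uminus)
  show ?case
    using sign_exponent_eq[OF assms y(3)] y
    by (simp add: ab(1) y_def[symmetric] sign f_symbol_def sqfree_monom_eq var_def
        move_def block_def deletion_sign_def scale_diff_right scale_single mult_single fterm_def)
next
  case (1 ab)
  then show ?case using label_x by auto
next
  case (2 ab)
  then show ?case by auto
next
  case (3 y)
  then show ?case using assms x_label[of y] by (auto simp: case_prod_unfold)
next
  case (4 y)
  then show ?case using assms x_label[of y] label_mem[of y] by (auto simp: case_prod_unfold)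
qed

lemma boundary_add: "boundary (\<phi> + \<psi>) = boundary \<phi> + boundary \<psi>"
  and boundary_scale: "boundary (scale q \<phi>) = scale q (boundary \<phi>)"
  and boundary_single:
    "boundary (Poly_Mapping.single (C, \<sigma>) p) = scale p (symbol_boundary r W n x C \<sigma>)"
proof -
  let ?g = "\<lambda>(C, \<sigma>) q. scale q (symbol_boundary r W n x C \<sigma>)"
  have *: "differential r W n x = coord_ext ?g"
    by (auto simp: differential_def coord_ext_def fun_eq_iff intro!: sum.cong)
  show "boundary (\<phi> + \<psi>) = boundary \<phi> + boundary \<psi>"
    unfolding * by (rule coord_ext_add) (auto simp: scale_add_left)
  show "boundary (scale q \<phi>) = scale q (boundary \<phi>)"
    unfolding * by (rule coord_ext_scale) (auto simp: scale_scale scale_add_right)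
  show "boundary (Poly_Mapping.single (C, \<sigma>) p) = scale p (symbol_boundary r W n x C \<sigma>)"
    unfolding * by (subst coord_ext_single) auto
qed

lemma boundary_fterm:
  assumes "\<sigma> \<subseteq> V"
  shows "boundary (fterm (C, \<sigma>) t c) =
    (\<Sum>y\<in>\<sigma>. fterm (move y C, \<sigma> - {y}) (t + w_mon y) (c * deletion_sign \<sigma> y)
      - fterm (C, \<sigma> - {y}) (t + x_mon y) (c * deletion_sign \<sigma> y))"
  unfolding fterm_def[of "(C, \<sigma>)" t c] boundary_single symbol_boundary_eq[OF assms]
  by (simp add: scale_sum scale_diff_right scale_fterm add.commute)

lemmas boundary_0 = additive_0[of boundary, OF boundary_add]
  and boundary_diff = additive_diff[of boundary, OF boundary_add]
  and boundary_sum = additive_sum[of boundary, OF boundary_add]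

lemma augmentation_add: "augmentation (\<phi> + \<psi>) = augmentation \<phi> + augmentation \<psi>"
  and augmentation_scale: "augmentation (scale q \<phi>) = q * augmentation \<phi>"
  and augmentation_fterm:
    "augmentation (fterm (C, \<sigma>) t c) = Poly_Mapping.single (t + set_monomial C) c"
proof -
  let ?g = "\<lambda>(C, \<sigma>) q. q * sqfree_monom C"
  have *: "augmentation = coord_ext ?g"
    by (auto simp: augmentation_def coord_ext_def fun_eq_iff intro!: sum.cong)
  show "augmentation (\<phi> + \<psi>) = augmentation \<phi> + augmentation \<psi>"
    unfolding * by (rule coord_ext_add) (auto simp: algebra_simps)
  show "augmentation (scale q \<phi>) = q * augmentation \<phi>"
    unfolding * by (rule coord_ext_scale) (auto simp: algebra_simps)
  show "augmentation (fterm (C, \<sigma>) t c) = Poly_Mapping.single (t + set_monomial C) c"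
    unfolding * fterm_def by (subst coord_ext_single) (auto simp: sqfree_monom_eq mult_single)
qed

lemmas augmentation_0 = additive_0[of augmentation, OF augmentation_add]
  and augmentation_diff = additive_diff[of augmentation, OF augmentation_add]
  and augmentation_sum = additive_sum[of augmentation, OF augmentation_add]

text \<open>The terms \<open>t f(C; \<sigma>)\<close> of homological degree \<open>p\<close> with \<open>\<sigma>\<close> disjoint from \<open>U\<close> and \<open>t\<close> not
  divisible by any vertex of \<open>U\<close> that is not in \<open>C\<close>. For \<open>U = {}\<close> these are all terms.\<close>

definition reduced_terms :: "nat \<Rightarrow> 'v set \<Rightarrow> ('v symb \<times> 'v wvertex monomial) set" where
  "reduced_terms p U = {((C, \<sigma>), t) | C \<sigma> t. (C, \<sigma>) \<in> symbs p \<and> supp t \<subseteq> VG \<and> \<sigma> \<inter> U = {} \<and>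
     (\<forall>u\<in>U. Old u \<notin> C \<longrightarrow> coeff t (Old u) = 0)}"

lemma mem_reduced_terms_iff:
  "((C, \<sigma>), t) \<in> reduced_terms p U \<longleftrightarrow> (C, \<sigma>) \<in> symbs p \<and> supp t \<subseteq> VG \<and> \<sigma> \<inter> U = {} \<and>
     (\<forall>u\<in>U. Old u \<notin> C \<longrightarrow> coeff t (Old u) = 0)"
  by (simp add: reduced_terms_def)

lemma carrier_cover_module: "carrier (cover_module V E r W n p) = term_span (reduced_terms p {})"
proof -
  have "{(b, t). b \<in> symbs p \<and> supp t \<subseteq> VG} = reduced_terms p {}"
    by (auto simp: reduced_terms_def)
  then show ?thesis by (simp add: cover_module_def carrier_free_module)
qed

lemma supp_add_w_mon: "y \<in> V \<Longrightarrow> supp t \<subseteq> VG \<Longrightarrow> supp (t + w_mon y) \<subseteq> VG"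
  using block_subset_VG[of y] supp_add_subset[of t "w_mon y"]
  by (auto simp: supp_set_monomial[OF finite_block])

lemma supp_add_x_mon: "y \<in> V \<Longrightarrow> supp t \<subseteq> VG \<Longrightarrow> supp (t + x_mon y) \<subseteq> VG"
  using supp_add_subset[of t "x_mon y"] by (auto simp: Old_in_VG)

lemma coeff_w_mon_Old [simp]: "coeff (w_mon y) (Old v) = 0"
  by (simp add: coeff_set_monomial finite_block) (simp add: block_eq)

lemma w_mon_nonzero: "y \<in> V \<Longrightarrow> w_mon y \<noteq> 0"
  using block_nonempty[of y] supp_set_monomial[OF finite_block, of y] by auto

lemma boundary_in_span:
  fixes \<phi> :: "('v symb, 'v wvertex, 'k::field) free_elem"
  assumes "\<phi> \<in> term_span (reduced_terms p {})"
  shows "boundary \<phi> \<in> term_span {(b, t). b \<in> symbs (p - 1) \<and> supp t \<subseteq> VG \<and> t \<noteq> 0}"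
  using assms boundary_add
proof (rule term_span_image)
  fix b :: "'v symb" and t :: "'v wvertex monomial" and c :: 'k
  assume bt: "(b, t) \<in> reduced_terms p {}"
  obtain C \<sigma> where b: "b = (C, \<sigma>)" by fastforce
  have \<sigma>: "\<sigma> \<subseteq> V" and sym: "(C, \<sigma>) \<in> symbs p" and t: "supp t \<subseteq> VG"
    using bt by (auto simp: b mem_reduced_terms_iff mem_symbols_iff)
  show "boundary (fterm b t c) \<in> term_span {(b, t). b \<in> symbs (p - 1) \<and> supp t \<subseteq> VG \<and> t \<noteq> 0}"
    unfolding b boundary_fterm[OF \<sigma>]
  proof (intro term_span_sum term_span_diff fterm_in_term_span CollectI case_prodI conjI)
    fix y assume y: "y \<in> \<sigma>"
    then have yV: "y \<in> V" using \<sigma> by auto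
    show "(move y C, \<sigma> - {y}) \<in> symbs (p - 1)" "(C, \<sigma> - {y}) \<in> symbs (p - 1)"
      using symbol_delete[OF sym y] by auto
    show "supp (t + w_mon y) \<subseteq> VG" "supp (t + x_mon y) \<subseteq> VG"
      using supp_add_w_mon supp_add_x_mon yV t by auto
    have "x_mon y \<noteq> 0" by (simp add: poly_mapping_eq_iff fun_eq_iff lookup_single when_def)
    then show "t + w_mon y \<noteq> 0" "t + x_mon y \<noteq> 0"
      using w_mon_nonzero[OF yV] by (auto simp: poly_mapping_eq_iff fun_eq_iff lookup_add)
  qed
qed

lemma boundary_closed:
  "\<phi> \<in> term_span (reduced_terms p {}) \<Longrightarrow> boundary \<phi> \<in> term_span (reduced_terms (p - 1) {})"
  by (rule term_span_mono[OF boundary_in_span]) (auto simp: reduced_terms_def)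

text \<open>The two ways of deleting a pair of vertices from \<open>\<sigma>\<close> give the same terms with opposite
  signs.\<close>

lemma boundary_boundary:
  fixes \<phi> :: "('v symb, 'v wvertex, 'k::field) free_elem"
  assumes "\<phi> \<in> term_span (reduced_terms p {})"
  shows "boundary (boundary \<phi>) = 0"
  using assms
proof (induction rule: term_span_induct)
  case (fterm b t c)
  obtain C \<sigma> where b: "b = (C, \<sigma>)" by fastforce
  have \<sigma>: "\<sigma> \<subseteq> V" using fterm by (auto simp: b mem_reduced_terms_iff mem_symbols_iff)
  then have sub: "\<sigma> - {y} \<subseteq> V" for y by auto
  define A where "A y z =
      fterm (move z (move y C), \<sigma> - {y} - {z}) (t + w_mon y + w_mon z) (c * deletion_sign \<sigma> y * deletion_sign (\<sigma> - {y}) z)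
      - fterm (move y C, \<sigma> - {y} - {z}) (t + w_mon y + x_mon z) (c * deletion_sign \<sigma> y * deletion_sign (\<sigma> - {y}) z)
      - (fterm (move z C, \<sigma> - {y} - {z}) (t + x_mon y + w_mon z) (c * deletion_sign \<sigma> y * deletion_sign (\<sigma> - {y}) z)
      - fterm (C, \<sigma> - {y} - {z}) (t + x_mon y + x_mon z) (c * deletion_sign \<sigma> y * deletion_sign (\<sigma> - {y}) z))"
    for y z
  have "boundary (boundary (fterm b t c)) = (\<Sum>y\<in>\<sigma>. \<Sum>z\<in>\<sigma> - {y}. A y z)"
    by (simp add: b boundary_fterm[OF \<sigma>] boundary_fterm[OF sub] boundary_sum boundary_diff A_def
        sum_subtractf)
  also have "\<dots> = 0"
  proof (rule sum_pairs_antisymmetric)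
    show "finite \<sigma>" using \<sigma> finite_V by (rule finite_subset)
    fix y z assume yz: "y \<in> \<sigma>" "z \<in> \<sigma>" "y \<noteq> z"
    define e where "e = c * deletion_sign \<sigma> y * deletion_sign (\<sigma> - {y}) z"
    have e: "c * deletion_sign \<sigma> z * deletion_sign (\<sigma> - {z}) y = - e"
      using deletion_sign_anticommute[OF \<sigma> yz, where 'k = 'k] by (simp add: e_def mult.assoc)
    have "\<sigma> - {z} - {y} = \<sigma> - {y} - {z}" by auto
    then show "A z y = - A y z"
      unfolding A_def e e_def[symmetric]
      by (simp add: fterm_uminus move_commute[of y z] add_ac)
  qed
  finally show ?case .
qed (auto simp: boundary_0 boundary_add)

text \<open>The two terms that belong to a vertex in the differential have the same multidegree. The
  whiskers at \<open>y\<close> lie in \<open>C\<close> since \<open>y\<close> does not.\<close>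

lemma set_monomial_move:
  assumes "min_vertex_cover VG EG C" and "y \<in> V" and "Old y \<notin> C"
  shows "w_mon y + set_monomial (move y C) = x_mon y + set_monomial C"
proof (rule poly_mapping_eqI)
  have "finite C" using assms(1) finite_subset[OF _ finite_VG] by (auto simp: min_vertex_cover_iff)
  then have "finite (move y C)" by (simp add: move_def)
  then show "coeff (w_mon y + set_monomial (move y C)) v = coeff (x_mon y + set_monomial C) v" for v
    using \<open>finite C\<close> finite_block[of y] block_subset_cover[OF assms] assms(3)
    by (auto simp: lookup_add coeff_set_monomial lookup_single when_def move_def)
qed

lemma augmentation_boundary:
  fixes \<phi> :: "('v symb, 'v wvertex, 'k::field) free_elem"
  assumes "\<phi> \<in> term_span (reduced_terms p {})"
  shows "augmentation (boundary \<phi>) = 0"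
  using assms
proof (induction rule: term_span_induct)
  case (fterm b t c)
  obtain C \<sigma> where b: "b = (C, \<sigma>)" by fastforce
  have \<sigma>: "\<sigma> \<subseteq> V" "\<forall>y\<in>\<sigma>. Old y \<notin> C" "min_vertex_cover VG EG C"
    using fterm by (auto simp: b mem_reduced_terms_iff mem_symbols_iff)
  have "t + w_mon y + set_monomial (move y C) = t + x_mon y + set_monomial C" if "y \<in> \<sigma>" for y
    using set_monomial_move[of C y] \<sigma> that by (auto simp: add.assoc)
  then show ?case
    by (simp add: b boundary_fterm[OF \<sigma>(1)] augmentation_sum augmentation_diff augmentation_fterm)
qed (auto simp: boundary_0 boundary_add augmentation_0 augmentation_add)

section \<open>The contracting homotopies\<close>

text \<open>For a vertex \<open>v\<close>, the map that is linear over the field, sends \<open>t f(C; \<sigma>)\<close> to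
  \<open>- \<epsilon> (t / v) f(C; \<sigma> \<union> {v})\<close> if \<open>v\<close> divides \<open>t\<close> and \<open>v \<notin> C \<union> \<sigma>\<close>, and to \<open>0\<close> otherwise. Here \<open>\<epsilon>\<close> is the
  sign of deleting \<open>v\<close> from \<open>\<sigma> \<union> {v}\<close>. The map is not linear over the polynomial ring.\<close>

definition homotopy :: "'v \<Rightarrow> ('v symb, 'v wvertex, 'k::field) free_elem \<Rightarrow>
    ('v symb, 'v wvertex, 'k) free_elem" where
  "homotopy v = coord_ext (\<lambda>b. coord_ext (\<lambda>t c.
     if Old v \<notin> fst b \<and> v \<notin> snd b \<and> coeff t (Old v) \<noteq> 0
     then fterm (fst b, insert v (snd b)) (t - x_mon v) (- (deletion_sign (insert v (snd b)) v * c))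
     else 0))"

lemma homotopy_add:
  fixes \<phi> \<psi> :: "('v symb, 'v wvertex, 'k::field) free_elem"
  shows "homotopy v (\<phi> + \<psi>) = homotopy v \<phi> + homotopy v \<psi>"
proof -
  have "fterm b t (- (s * (c + c'))) = fterm b t (- (s * c)) + fterm b t (- (s * c'))"
    for b :: "'v symb" and t :: "'v wvertex monomial" and s c c' :: 'k
    by (simp add: fterm_def single_add[symmetric] algebra_simps)
  then show ?thesis
    unfolding homotopy_def by (intro coord_ext_add) auto
qed

lemma homotopy_fterm:
  "homotopy v (fterm (C, \<sigma>) t c) =
     (if Old v \<notin> C \<and> v \<notin> \<sigma> \<and> coeff t (Old v) \<noteq> 0
      then fterm (C, insert v \<sigma>) (t - x_mon v) (- (deletion_sign (insert v \<sigma>) v * c)) else 0)"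
  unfolding homotopy_def by (subst coord_ext_fterm) auto

lemmas homotopy_0 = additive_0[of "homotopy v", OF homotopy_add]
  and homotopy_diff = additive_diff[of "homotopy v", OF homotopy_add]
  and homotopy_sum = additive_sum[of "homotopy v", OF homotopy_add] for v

lemma homotopy_closed:
  fixes \<phi> :: "('v symb, 'v wvertex, 'k::field) free_elem"
  assumes "\<phi> \<in> term_span (reduced_terms p {})" and v: "v \<in> V"
  shows "homotopy v \<phi> \<in> term_span (reduced_terms (p + 1) {})"
  using assms(1) homotopy_add
proof (rule term_span_image)
  fix b :: "'v symb" and t :: "'v wvertex monomial" and c :: 'k
  assume bt: "(b, t) \<in> reduced_terms p {}"
  obtain C \<sigma> where b: "b = (C, \<sigma>)" by fastforce
  have sym: "(C, \<sigma>) \<in> symbs p" and t: "supp t \<subseteq> VG"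
    using bt by (auto simp: b mem_reduced_terms_iff)
  have "finite \<sigma>" using sym finite_subset[OF _ finite_V] by (auto simp: mem_symbols_iff)
  then have "(C, insert v \<sigma>) \<in> symbs (p + 1)" if "Old v \<notin> C" "v \<notin> \<sigma>"
    using sym v that by (auto simp: mem_symbols_iff)
  moreover have "supp (t - x_mon v) \<subseteq> VG"
    using t by (auto simp: in_keys_iff lookup_minus)
  ultimately show "homotopy v (fterm b t c) \<in> term_span (reduced_terms (p + 1) {})"
    unfolding b homotopy_fterm
    by (auto intro!: fterm_in_term_span zero_in_term_span simp: mem_reduced_terms_iff)
qed

text \<open>The homotopy of \<open>v\<close> connects the identity with a projection onto the span of the terms that are
  reduced at \<open>v\<close>, and the projection preserves reducedness at other vertices. It takes \<open>t f(C; \<sigma>)\<close> to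
  \<open>0\<close> if \<open>v \<in> \<sigma>\<close>, to \<open>(t / v) w f(move v C; \<sigma>)\<close> if \<open>v\<close> divides \<open>t\<close> and \<open>v \<notin> C \<union> \<sigma>\<close>, where \<open>w\<close> is the
  product of the whiskers at the clique of \<open>v\<close>, and to itself in the remaining case.\<close>

lemma homotopy_identity_fterm:
  fixes c :: "'k::field"
  assumes T: "((C, \<sigma>), t) \<in> reduced_terms p U" and v: "v \<in> V"
  defines "m \<equiv> fterm (C, \<sigma>) t c"
  shows "m - boundary (homotopy v m) - homotopy v (boundary m) \<in> term_span (reduced_terms p (insert v U))"
proof -
  have sym: "(C, \<sigma>) \<in> symbs p" and t: "supp t \<subseteq> VG" and \<sigma>U: "\<sigma> \<inter> U = {}"
    and red: "\<And>u. u \<in> U \<Longrightarrow> Old u \<notin> C \<Longrightarrow> coeff t (Old u) = 0"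
    using T by (auto simp: mem_reduced_terms_iff)
  have \<sigma>: "\<sigma> \<subseteq> V" and C: "min_vertex_cover VG EG C" and \<sigma>C: "\<And>y. y \<in> \<sigma> \<Longrightarrow> Old y \<notin> C"
    using sym by (auto simp: mem_symbols_iff)
  have fin: "finite \<sigma>" using \<sigma> finite_V by (rule finite_subset)
  have hm: "homotopy v (boundary m) =
      (\<Sum>y\<in>\<sigma>. homotopy v (fterm (move y C, \<sigma> - {y}) (t + w_mon y) (c * deletion_sign \<sigma> y))
        - homotopy v (fterm (C, \<sigma> - {y}) (t + x_mon y) (c * deletion_sign \<sigma> y)))"
    unfolding m_def boundary_fterm[OF \<sigma>] homotopy_sum homotopy_diff ..
  consider "v \<in> \<sigma>" | "v \<notin> \<sigma>" "Old v \<in> C \<or> coeff t (Old v) = 0"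
    | "v \<notin> \<sigma>" "Old v \<notin> C" "coeff t (Old v) \<noteq> 0" by blast
  then show ?thesis
  proof cases
    case 1
    \<comment> \<open>Only the summand that deletes \<open>v\<close> from \<open>\<sigma>\<close> and keeps \<open>C\<close> survives.\<close>
    have "homotopy v (boundary m) = (\<Sum>y\<in>\<sigma>. if v = y then m else 0)"
      unfolding hm
    proof (rule sum.cong)
      fix y assume y: "y \<in> \<sigma>"
      show "homotopy v (fterm (move y C, \<sigma> - {y}) (t + w_mon y) (c * deletion_sign \<sigma> y))
        - homotopy v (fterm (C, \<sigma> - {y}) (t + x_mon y) (c * deletion_sign \<sigma> y)) = (if v = y then m else 0)"
      proof (cases "v = y")
        case True
        have "insert v (\<sigma> - {v}) = \<sigma>" using 1 by auto
        moreover have "fterm (C, \<sigma>) t (deletion_sign \<sigma> v * (c * deletion_sign \<sigma> v)) = m"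
          by (simp add: m_def mult.left_commute deletion_sign_square)
        ultimately show ?thesis
          using \<sigma>C[OF 1] by (simp add: True[symmetric] homotopy_fterm Old_in_move lookup_add fterm_uminus)
      next
        case False
        then show ?thesis using 1 by (simp add: homotopy_fterm)
      qed
    qed simp
    then have "homotopy v (boundary m) = m" using fin 1 by simp
    moreover have "homotopy v m = 0" using 1 by (simp add: m_def homotopy_fterm)
    ultimately show ?thesis by (simp add: boundary_0 zero_in_term_span)
  next
    case 2
    have "homotopy v (fterm (move y C, \<sigma> - {y}) (t + w_mon y) (c * deletion_sign \<sigma> y)) = 0"
      "homotopy v (fterm (C, \<sigma> - {y}) (t + x_mon y) (c * deletion_sign \<sigma> y)) = 0" if "y \<in> \<sigma>" for y
      using 2 that by (auto simp: homotopy_fterm Old_in_move lookup_add lookup_single when_def)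
    then have "homotopy v (boundary m) = 0" unfolding hm by simp
    moreover have "homotopy v m = 0" using 2 by (auto simp: m_def homotopy_fterm)
    moreover have "m \<in> term_span (reduced_terms p (insert v U))"
      unfolding m_def using sym t \<sigma>U red 2
      by (intro fterm_in_term_span) (auto simp: mem_reduced_terms_iff)
    ultimately show ?thesis by (simp add: boundary_0)
  next
    case 3
    let ?\<tau> = "insert v \<sigma>"
    define s :: 'k where "s = deletion_sign ?\<tau> v"
    define t' where "t' = t - x_mon v"
    have t_eq: "t = t' + x_mon v"
      using 3 by (auto intro!: poly_mapping_eqI simp: t'_def lookup_add lookup_minus lookup_single when_def)
    have \<tau>: "?\<tau> \<subseteq> V" using \<sigma> v by simp
    \<comment> \<open>The summands of \<open>d h m\<close>. The one for \<open>v\<close> contributes \<open>m\<close> and the term of the projection; the others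
      cancel against \<open>h d m\<close>.\<close>
    define G where "G y = fterm (move y C, ?\<tau> - {y}) (t' + w_mon y) (- (s * c) * deletion_sign ?\<tau> y)
      - fterm (C, ?\<tau> - {y}) (t' + x_mon y) (- (s * c) * deletion_sign ?\<tau> y)" for y
    have s2: "s * c * s = c"
      unfolding s_def by (simp add: mult.assoc mult.left_commute[of _ c] deletion_sign_square)
    have "homotopy v m = fterm (C, ?\<tau>) t' (- (s * c))"
      using 3 by (simp add: m_def homotopy_fterm s_def t'_def)
    then have "boundary (homotopy v m) = (\<Sum>y\<in>?\<tau>. G y)"
      by (simp only: boundary_fterm[OF \<tau>] G_def)
    also have "\<dots> = G v + (\<Sum>y\<in>\<sigma>. G y)" using fin 3 by simp
    also have "G v = m - fterm (move v C, \<sigma>) (t' + w_mon v) c"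
    proof -
      have "?\<tau> - {v} = \<sigma>" using 3 by auto
      then show ?thesis
        unfolding G_def s_def[symmetric] mult_minus_left s2 t_eq[symmetric] m_def fterm_uminus by simp
    qed
    finally have dh: "boundary (homotopy v m) = m - fterm (move v C, \<sigma>) (t' + w_mon v) c + (\<Sum>y\<in>\<sigma>. G y)" .
    have "homotopy v (fterm (move y C, \<sigma> - {y}) (t + w_mon y) (c * deletion_sign \<sigma> y))
        - homotopy v (fterm (C, \<sigma> - {y}) (t + x_mon y) (c * deletion_sign \<sigma> y)) = - G y" if y: "y \<in> \<sigma>" for y
    proof -
      have "v \<noteq> y" using y 3 by auto
      then have \<tau>y: "insert v (\<sigma> - {y}) = ?\<tau> - {y}" by auto
      have sign: "- (deletion_sign (?\<tau> - {y}) v * (c * deletion_sign \<sigma> y)) = s * c * deletion_sign ?\<tau> y"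
        using deletion_sign_insert[OF \<tau> y 3(1), where 'k = 'k]
        by (simp add: s_def \<tau>y algebra_simps)
      have "t + w_mon y - x_mon v = t' + w_mon y" "t + x_mon y - x_mon v = t' + x_mon y"
        unfolding t_eq by (auto intro!: poly_mapping_eqI simp: lookup_add lookup_minus)
      then show ?thesis
        using 3 \<open>v \<noteq> y\<close>
        by (simp add: homotopy_fterm Old_in_move lookup_add \<tau>y sign G_def fterm_uminus)
    qed
    then have hd: "homotopy v (boundary m) = - (\<Sum>y\<in>\<sigma>. G y)"
      unfolding hm by (simp add: sum_negf)
    have "((move v C, \<sigma>), t' + w_mon v) \<in> reduced_terms p (insert v U)"
      unfolding mem_reduced_terms_iff
    proof (intro conjI ballI impI)
      show "(move v C, \<sigma>) \<in> symbs p"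
        using sym 3 min_vertex_cover_move[OF C v] by (auto simp: mem_symbols_iff Old_in_move)
      have "supp t' \<subseteq> VG" using t by (auto simp: t'_def in_keys_iff lookup_minus)
      then show "supp (t' + w_mon v) \<subseteq> VG" by (rule supp_add_w_mon[OF v])
      show "\<sigma> \<inter> insert v U = {}" using \<sigma>U 3 by auto
      show "coeff (t' + w_mon v) (Old u) = 0" if "u \<in> insert v U" "Old u \<notin> move v C" for u
        using that red[of u] by (auto simp: Old_in_move t'_def lookup_add lookup_minus)
    qed
    then have "fterm (move v C, \<sigma>) (t' + w_mon v) c \<in> term_span (reduced_terms p (insert v U))"
      by (rule fterm_in_term_span)
    then show ?thesis by (simp add: dh hd)
  qed
qed

lemma homotopy_identity:
  fixes \<phi> :: "('v symb, 'v wvertex, 'k::field) free_elem"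
  assumes "\<phi> \<in> term_span (reduced_terms p U)" and "v \<in> V"
  shows "\<phi> - boundary (homotopy v \<phi>) - homotopy v (boundary \<phi>)
    \<in> term_span (reduced_terms p (insert v U))"
  using assms(1)
proof (rule term_span_image[where h = "\<lambda>\<phi>. \<phi> - boundary (homotopy v \<phi>) - homotopy v (boundary \<phi>)"])
  fix b :: "'v symb" and t :: "'v wvertex monomial" and c :: 'k
  assume "(b, t) \<in> reduced_terms p U"
  then show "fterm b t c - boundary (homotopy v (fterm b t c)) - homotopy v (boundary (fterm b t c))
      \<in> term_span (reduced_terms p (insert v U))"
    using homotopy_identity_fterm[OF _ assms(2)] by (cases b) simp
qed (simp add: boundary_add homotopy_add)

lemma reduced_terms_mono: "reduced_terms p U \<subseteq> reduced_terms p {}"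
  by (auto simp: reduced_terms_def)

text \<open>Modulo boundaries, a cycle is a combination of terms that are reduced at any given set of
  vertices.\<close>

lemma cycle_reduction:
  fixes \<phi> :: "('v symb, 'v wvertex, 'k::field) free_elem"
  assumes "finite U" and "U \<subseteq> V"
    and \<phi>: "\<phi> \<in> term_span (reduced_terms p {})" and cycle: "boundary \<phi> = 0"
  shows "\<exists>\<psi>\<in>term_span (reduced_terms (p + 1) {}). \<phi> - boundary \<psi> \<in> term_span (reduced_terms p U)"
  using assms(1,2)
proof (induction U rule: finite_induct)
  case empty
  then show ?case using \<phi> by (auto intro!: bexI[of _ 0] simp: boundary_0 zero_in_term_span)
next
  case (insert v U)
  then obtain \<psi> where \<psi>: "\<psi> \<in> term_span (reduced_terms (p + 1) {})"
    and red: "\<phi> - boundary \<psi> \<in> term_span (reduced_terms p U)" by auto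
  define \<phi>' where "\<phi>' = \<phi> - boundary \<psi>"
  have "boundary \<phi>' = 0"
    using boundary_boundary[OF \<psi>] cycle by (simp add: \<phi>'_def boundary_diff)
  then have "\<phi>' - boundary (homotopy v \<phi>') \<in> term_span (reduced_terms p (insert v U))"
    using homotopy_identity[of \<phi>' p U v] red insert.prems by (simp add: \<phi>'_def[symmetric] homotopy_0)
  moreover have "\<phi>' - boundary (homotopy v \<phi>') = \<phi> - boundary (\<psi> + homotopy v \<phi>')"
    by (simp add: boundary_add \<phi>'_def)
  moreover have "homotopy v \<phi>' \<in> term_span (reduced_terms (p + 1) {})"
    using term_span_mono[OF red reduced_terms_mono] insert.prems
    by (intro homotopy_closed) (auto simp: \<phi>'_def)
  ultimately show ?case
    using term_span_add[OF \<psi>] by (intro bexI[of _ "\<psi> + homotopy v \<phi>'"]) auto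
qed

lemma exact_positive:
  fixes \<phi> :: "('v symb, 'v wvertex, 'k::field) free_elem"
  assumes "p > 0" and "\<phi> \<in> term_span (reduced_terms p {})" and "boundary \<phi> = 0"
  shows "\<exists>\<psi>\<in>term_span (reduced_terms (p + 1) {}). \<phi> = boundary \<psi>"
proof -
  obtain \<psi> where \<psi>: "\<psi> \<in> term_span (reduced_terms (p + 1) {})"
    and red: "\<phi> - boundary \<psi> \<in> term_span (reduced_terms p V)"
    using cycle_reduction[OF finite_V subset_refl assms(2,3)] by blast
  \<comment> \<open>A nonempty \<open>\<sigma> \<subseteq> V\<close> is not disjoint from \<open>V\<close>.\<close>
  have "\<sigma> = {}" if "\<sigma> \<subseteq> V" "\<sigma> \<inter> V = {}" for \<sigma> using that by auto
  then have "reduced_terms p V = {}"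
    using assms(1) by (fastforce simp: reduced_terms_def mem_symbols_iff)
  then have "\<phi> - boundary \<psi> = 0"
    using red by (intro term_span_eq_0) auto
  then show ?thesis using \<psi> by (intro bexI[of _ \<psi>]) auto
qed

text \<open>The monomial \<open>t z\<^sub>C\<close> of a reduced term \<open>t f(C; {})\<close> is not divisible by the vertices outside
  \<open>C\<close>, so it determines \<open>C\<close>.\<close>

lemma inj_on_reduced_terms_0:
  "inj_on (\<lambda>(b, t). t + set_monomial (fst b)) (reduced_terms 0 V)"
proof (rule inj_onI)
  fix b b' :: "'v symb \<times> 'v wvertex monomial"
  assume b: "b \<in> reduced_terms 0 V" "b' \<in> reduced_terms 0 V"
    and eq': "(\<lambda>(b, t). t + set_monomial (fst b)) b = (\<lambda>(b, t). t + set_monomial (fst b)) b'"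
  obtain C \<sigma> t C' \<sigma>' t' where bb': "b = ((C, \<sigma>), t)" "b' = ((C', \<sigma>'), t')"
    by (metis prod.collapse)
  have T: "((C, \<sigma>), t) \<in> reduced_terms 0 V" "((C', \<sigma>'), t') \<in> reduced_terms 0 V"
    and eq: "t + set_monomial C = t' + set_monomial C'"
    using b eq' by (auto simp: bb')
  have C: "min_vertex_cover VG EG C" "min_vertex_cover VG EG C'"
    and red: "\<And>v. v \<in> V \<Longrightarrow> Old v \<notin> C \<Longrightarrow> coeff t (Old v) = 0"
      "\<And>v. v \<in> V \<Longrightarrow> Old v \<notin> C' \<Longrightarrow> coeff t' (Old v) = 0"
    and "\<sigma> \<subseteq> V" "\<sigma>' \<subseteq> V" "\<sigma> \<inter> V = {}" "\<sigma>' \<inter> V = {}"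
    using T by (auto simp: mem_reduced_terms_iff mem_symbols_iff)
  then have \<sigma>: "\<sigma> = {}" "\<sigma>' = {}" by auto
  have fin: "finite C" "finite C'"
    using C finite_subset[OF _ finite_VG] by (auto simp: min_vertex_cover_iff)
  have "C = C'"
  proof (rule min_vertex_cover_eqI[OF C])
    fix v assume v: "v \<in> V"
    have "coeff (t + set_monomial C) (Old v) = coeff (t' + set_monomial C') (Old v)"
      using eq by simp
    then show "Old v \<in> C \<longleftrightarrow> Old v \<in> C'"
      using red[OF v] by (auto simp: lookup_add coeff_set_monomial fin split: if_splits)
  qed
  then show "b = b'" using eq \<sigma> by (simp add: bb')
qed

lemma exact_zero:
  fixes \<phi> :: "('v symb, 'v wvertex, 'k::field) free_elem"
  assumes "\<phi> \<in> term_span (reduced_terms 0 {})" and aug: "augmentation \<phi> = 0"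
  shows "\<exists>\<psi>\<in>term_span (reduced_terms 1 {}). \<phi> = boundary \<psi>"
proof -
  have "boundary \<phi> = 0"
    using assms(1)
  proof (induction rule: term_span_induct)
    case (fterm b t c)
    then obtain C where "b = (C, {})"
      using finite_subset[OF _ finite_V] by (cases b) (auto simp: mem_reduced_terms_iff mem_symbols_iff)
    then show ?case by (simp add: boundary_fterm)
  qed (auto simp: boundary_0 boundary_add)
  then obtain \<psi> where \<psi>: "\<psi> \<in> term_span (reduced_terms 1 {})"
    and red: "\<phi> - boundary \<psi> \<in> term_span (reduced_terms 0 V)"
    using cycle_reduction[OF finite_V subset_refl assms(1)] by auto
  define \<phi>' where "\<phi>' = \<phi> - boundary \<psi>"
  have "augmentation \<phi>' = 0"
    using augmentation_boundary[OF \<psi>] aug by (simp add: \<phi>'_def augmentation_diff)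
  moreover have "\<forall>(b, t)\<in>reduced_terms 0 V. coeff (augmentation \<phi>') ((\<lambda>(b, t). t + set_monomial (fst b)) (b, t))
      = coeff (coeff \<phi>' b) t"
    using red unfolding \<phi>'_def[symmetric]
    by (rule coeff_monomial_map[OF _ augmentation_add _ inj_on_reduced_terms_0])
      (auto simp: augmentation_fterm)
  ultimately have "\<And>b t. (b, t) \<in> reduced_terms 0 V \<Longrightarrow> coeff (coeff \<phi>' b) t = 0"
    by auto
  then have "\<phi>' = 0"
    using red unfolding \<phi>'_def[symmetric] by (rule term_span_eq_0)
  then show ?thesis using \<psi> by (intro bexI[of _ \<psi>]) (auto simp: \<phi>'_def)
qed

section \<open>The resolution\<close>

lemma cover_generators_in_polys:
  "{sqfree_monom C | C. vertex_cover VG EG C} \<subseteq> (polys_in VG :: ('v wvertex, 'k::field) mpoly set)"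
  using finite_subset[OF _ finite_VG]
  by (auto simp: vertex_cover_def intro!: sqfree_monom_in_polys)

lemma ideal_cover_ideal:
  "ideal (cover_ideal VG EG :: ('v wvertex, 'k::field) mpoly set) (poly_ring VG)"
proof -
  interpret R: cring "poly_ring VG :: ('v wvertex, 'k) mpoly ring" by (rule cring_poly_ring)
  show ?thesis
    unfolding cover_ideal_def using cover_generators_in_polys by (intro R.genideal_ideal) simp
qed

lemma augmentation_image:
  "augmentation ` term_span (reduced_terms 0 {}) = (cover_ideal VG EG :: ('v wvertex, 'k::field) mpoly set)"
proof
  interpret R: cring "poly_ring VG :: ('v wvertex, 'k) mpoly ring" by (rule cring_poly_ring)
  let ?J = "cover_ideal VG EG :: ('v wvertex, 'k) mpoly set"
  let ?I = "augmentation ` term_span (reduced_terms 0 {}) :: ('v wvertex, 'k) mpoly set"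
  note J = poly_ideal_closed[OF ideal_cover_ideal, where 'k = 'k]
  show "?I \<subseteq> ?J"
  proof clarify
    fix \<phi> :: "('v symb, 'v wvertex, 'k) free_elem"
    assume "\<phi> \<in> term_span (reduced_terms 0 {})"
    then show "augmentation \<phi> \<in> ?J"
    proof (induction rule: term_span_induct)
      case (fterm b t c)
      obtain C \<sigma> where b: "b = (C, \<sigma>)" by fastforce
      have C: "vertex_cover VG EG C" and t: "supp t \<subseteq> VG"
        using fterm by (auto simp: b mem_reduced_terms_iff mem_symbols_iff min_vertex_cover_def)
      have "sqfree_monom C \<in> ?J"
        unfolding cover_ideal_def using C cover_generators_in_polys
        by (intro subsetD[OF R.genideal_self]) auto
      then have "Poly_Mapping.single t c * sqfree_monom C \<in> ?J"
        using polys_in_single[OF t] by (rule J(4))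
      then show ?case
        by (simp add: b augmentation_fterm sqfree_monom_eq mult_single)
    qed (use J in \<open>auto simp: augmentation_0 augmentation_add\<close>)
  qed
  have polys: "?I \<subseteq> polys_in VG" using \<open>?I \<subseteq> ?J\<close> J(5) by blast
  have "ideal ?I (poly_ring VG)"
  proof (rule poly_idealI[OF polys])
    show "0 \<in> ?I"
      by (rule image_eqI[of _ _ 0]) (simp_all add: augmentation_0 zero_in_term_span)
    fix p q assume "p \<in> ?I" "q \<in> ?I"
    then obtain \<phi> \<psi> where "\<phi> \<in> term_span (reduced_terms 0 {})" "p = augmentation \<phi>"
      "\<psi> \<in> term_span (reduced_terms 0 {})" "q = augmentation \<psi>" by blast
    then show "p + q \<in> ?I"
      by (intro image_eqI[of _ _ "\<phi> + \<psi>"] term_span_add) (simp_all add: augmentation_add)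
  next
    fix c p :: "('v wvertex, 'k) mpoly" assume "c \<in> polys_in VG" "p \<in> ?I"
    then obtain \<phi> where \<phi>: "\<phi> \<in> term_span (reduced_terms 0 {})" "p = augmentation \<phi>" by blast
    have "scale c \<phi> \<in> term_span (reduced_terms 0 {})"
      using scale_in_free_module[OF \<open>c \<in> polys_in VG\<close>, of \<phi> "symbs 0"] \<phi>(1)
      by (simp add: carrier_cover_module[symmetric] cover_module_def)
    then show "c * p \<in> ?I"
      unfolding \<phi>(2) augmentation_scale[symmetric] by (rule imageI)
  qed
  moreover have "{sqfree_monom C | C. vertex_cover VG EG C} \<subseteq> ?I"
  proof clarify
    fix C assume C: "vertex_cover VG EG C"
    then have fin: "finite C" and "C \<subseteq> VG"
      using finite_subset[OF _ finite_VG] by (auto simp: vertex_cover_def)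
    obtain D where D: "D \<subseteq> C" "min_vertex_cover VG EG D"
      using vertex_cover_contains_min[OF fin C] by blast
    have "supp (set_monomial (C - D)) \<subseteq> VG"
      using fin \<open>C \<subseteq> VG\<close> by (auto simp: supp_set_monomial)
    then have "fterm (D, {}) (set_monomial (C - D)) 1 \<in> term_span (reduced_terms 0 {})"
      using D(2) by (intro fterm_in_term_span) (simp add: mem_reduced_terms_iff mem_symbols_iff)
    moreover have "augmentation (fterm (D, {}) (set_monomial (C - D)) 1) = (sqfree_monom C :: ('v wvertex, 'k) mpoly)"
      using sqfree_monom_superset[OF fin D(1), where 'k = 'k]
      by (simp add: augmentation_fterm sqfree_monom_eq mult_single add.commute)
    ultimately show "sqfree_monom C \<in> ?I" by (intro image_eqI) (rule sym)
  qed
  ultimately show "?J \<subseteq> ?I"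
    unfolding cover_ideal_def by (rule R.genideal_minimal)
qed

lemma cover_module_simps [simp]:
  "zero (cover_module V E r W n p) = 0" "add (cover_module V E r W n p) = (+)"
  "smult (cover_module V E r W n p) = scale"
  by (simp_all add: cover_module_def)

lemma free_resolution_cover_ideal:
  "free_resolution (poly_ring VG) (cover_module V E r W n) (\<lambda>_. boundary) augmentation
     (ideal_module (cover_ideal VG EG :: ('v wvertex, 'k::field) mpoly set))"
  unfolding free_resolution_def
proof (intro conjI allI impI)
  let ?S = "poly_ring VG :: ('v wvertex, 'k) mpoly ring"
  let ?F = "cover_module V E r W n :: nat \<Rightarrow> (('v wvertex, 'k) mpoly, _) module"
  let ?J = "cover_ideal VG EG :: ('v wvertex, 'k) mpoly set"
  show "module ?S (ideal_module ?J)"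
    by (rule module_ideal_module[OF ideal_cover_ideal])
  show "augmentation \<in> module_hom ?S (?F 0) (ideal_module ?J)"
    using augmentation_image[where 'k = 'k]
    by (auto simp: module_hom_def carrier_cover_module augmentation_add augmentation_scale)
  show "augmentation ` carrier (?F 0) = carrier (ideal_module ?J)"
    by (simp add: carrier_cover_module augmentation_image)
  show "boundary ` carrier (?F 1) = module_ker (?F 0) (ideal_module ?J) augmentation"
  proof
    show "boundary ` carrier (?F 1) \<subseteq> module_ker (?F 0) (ideal_module ?J) augmentation"
      using boundary_closed[of _ 1] augmentation_boundary[of _ 1]
      by (auto simp: module_ker_def carrier_cover_module)
    show "module_ker (?F 0) (ideal_module ?J) augmentation \<subseteq> boundary ` carrier (?F 1)"
      using exact_zero by (auto simp: module_ker_def carrier_cover_module image_iff)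
  qed
  fix p
  show "module ?S (?F p)"
    by (simp add: cover_module_def module_free_module)
  show "\<exists>B. module_basis ?S (?F p) B"
    using module_basis_free_module[OF finite_symbols] unfolding cover_module_def by blast
  assume p: "p > 0"
  show "boundary \<in> module_hom ?S (?F p) (?F (p - 1))"
    using boundary_closed by (auto simp: module_hom_def carrier_cover_module boundary_add boundary_scale)
  show "boundary ` carrier (?F (p + 1)) = module_ker (?F p) (?F (p - 1)) boundary"
  proof
    show "boundary ` carrier (?F (p + 1)) \<subseteq> module_ker (?F p) (?F (p - 1)) boundary"
      using boundary_closed[of _ "p + 1"] boundary_boundary[of _ "p + 1"]
      by (auto simp: module_ker_def carrier_cover_module)
    show "module_ker (?F p) (?F (p - 1)) boundary \<subseteq> boundary ` carrier (?F (p + 1))"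
      using exact_positive[OF p] by (auto simp: module_ker_def carrier_cover_module image_iff)
  qed
qed

lemma boundary_minimal:
  fixes \<phi> :: "('v symb, 'v wvertex, 'k::field) free_elem"
  assumes "\<phi> \<in> carrier (cover_module V E r W n p)"
  shows "boundary \<phi> \<in> ideal_smult (poly_ring VG) (irrelevant_ideal VG) (cover_module V E r W n (p - 1))"
  unfolding cover_module_def
  using assms by (intro term_span_subset_irrelevant_smult boundary_in_span) (simp add: carrier_cover_module)

lemma symbol_deg_eq: "symbol_deg (C, \<sigma>) = set_monomial C + (\<Sum>y\<in>\<sigma>. x_mon y)"
  by (simp add: symbol_deg_def set_monomial_def)

lemma symbol_deg_delete:
  assumes "(C, \<sigma>) \<in> symbs p" and "y \<in> \<sigma>"
  shows "x_mon y + symbol_deg (C, \<sigma> - {y}) = symbol_deg (C, \<sigma>)"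
    and "w_mon y + symbol_deg (move y C, \<sigma> - {y}) = symbol_deg (C, \<sigma>)"
proof -
  have \<sigma>: "\<sigma> \<subseteq> V" "Old y \<notin> C" "min_vertex_cover VG EG C"
    using assms by (auto simp: mem_symbols_iff)
  have "finite \<sigma>" using \<sigma>(1) finite_V by (rule finite_subset)
  then have sum: "(\<Sum>z\<in>\<sigma>. x_mon z) = x_mon y + (\<Sum>z\<in>\<sigma> - {y}. x_mon z)"
    using assms(2) by (rule sum.remove)
  show "x_mon y + symbol_deg (C, \<sigma> - {y}) = symbol_deg (C, \<sigma>)"
    by (simp only: symbol_deg_eq sum add_ac)
  have "w_mon y + set_monomial (move y C) = x_mon y + set_monomial C"
    using \<sigma> assms(2) by (intro set_monomial_move) auto
  then have "w_mon y + set_monomial (move y C) + (\<Sum>z\<in>\<sigma> - {y}. x_mon z) =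
      x_mon y + set_monomial C + (\<Sum>z\<in>\<sigma> - {y}. x_mon z)" by simp
  then show "w_mon y + symbol_deg (move y C, \<sigma> - {y}) = symbol_deg (C, \<sigma>)"
    unfolding symbol_deg_eq sum by (simp only: add_ac)
qed

lemma boundary_homogeneous:
  fixes \<phi> :: "('v symb, 'v wvertex, 'k::field) free_elem"
  assumes "\<phi> \<in> free_component VG (symbs p) symbol_deg m"
  shows "boundary \<phi> \<in> free_component VG (symbs (p - 1)) symbol_deg m"
  using assms boundary_add unfolding free_component_eq
proof (rule term_span_image)
  fix b :: "'v symb" and t :: "'v wvertex monomial" and c :: 'k
  assume bt: "(b, t) \<in> {(b, t). b \<in> symbs p \<and> supp t \<subseteq> VG \<and> t + symbol_deg b = m}"
  obtain C \<sigma> where b: "b = (C, \<sigma>)" by fastforce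
  have \<sigma>: "\<sigma> \<subseteq> V" and sym: "(C, \<sigma>) \<in> symbs p" and t: "supp t \<subseteq> VG" and m: "t + symbol_deg (C, \<sigma>) = m"
    using bt by (auto simp: b mem_symbols_iff)
  show "boundary (fterm b t c) \<in> term_span {(b, t). b \<in> symbs (p - 1) \<and> supp t \<subseteq> VG \<and> t + symbol_deg b = m}"
    unfolding b boundary_fterm[OF \<sigma>]
  proof (intro term_span_sum term_span_diff fterm_in_term_span CollectI case_prodI conjI)
    fix y assume y: "y \<in> \<sigma>"
    then have yV: "y \<in> V" using \<sigma> by auto
    show "(move y C, \<sigma> - {y}) \<in> symbs (p - 1)" "(C, \<sigma> - {y}) \<in> symbs (p - 1)"
      using symbol_delete[OF sym y] by auto
    show "supp (t + w_mon y) \<subseteq> VG" "supp (t + x_mon y) \<subseteq> VG"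
      using supp_add_w_mon supp_add_x_mon yV t by auto
    show "t + w_mon y + symbol_deg (move y C, \<sigma> - {y}) = m"
      "t + x_mon y + symbol_deg (C, \<sigma> - {y}) = m"
      by (simp_all only: add.assoc symbol_deg_delete[OF sym y] m)
  qed
qed

lemma augmentation_homogeneous:
  fixes \<phi> :: "('v symb, 'v wvertex, 'k::field) free_elem"
  assumes "\<phi> \<in> free_component VG (symbs 0) symbol_deg m"
  shows "augmentation \<phi> \<in> poly_component (cover_ideal VG EG) m"
proof -
  have "\<phi> \<in> term_span (reduced_terms 0 {})"
    using assms by (simp add: free_component_def carrier_cover_module[symmetric] cover_module_def)
  then have "augmentation \<phi> \<in> cover_ideal VG EG"
    using augmentation_image by blast
  moreover have "supp (augmentation \<phi>) \<subseteq> {m}"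
    using assms unfolding free_component_eq
  proof (induction rule: term_span_induct)
    case (add \<phi> \<psi>)
    then show ?case
      using supp_add_subset[of "augmentation \<phi>" "augmentation \<psi>"] by (auto simp: augmentation_add)
  next
    case (fterm b t c)
    obtain C \<sigma> where b: "b = (C, \<sigma>)" by fastforce
    have "\<sigma> = {}"
      using fterm finite_subset[OF _ finite_V] by (auto simp: b mem_symbols_iff)
    then show ?case
      using fterm by (auto simp: b augmentation_fterm symbol_deg_eq)
  qed (simp add: augmentation_0)
  ultimately show ?thesis by (simp add: poly_component_def)
qed

end

theorem theorem5p5:
  fixes V :: "'v set" and E :: "'v set set"
    and r :: nat and W :: "nat \<Rightarrow> 'v set" and x :: "nat \<Rightarrow> nat \<Rightarrow> 'v" and n :: "nat \<Rightarrow> nat"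
    and V\<Gamma> :: "'v wvertex set" and E\<Gamma> :: "'v wvertex set set"
    and S :: "('v wvertex, 'k::field) mpoly ring"
    and J :: "('v wvertex, 'k) mpoly set"
    and F :: "nat \<Rightarrow> (('v wvertex, 'k) mpoly, ('v symb, 'v wvertex, 'k) free_elem) module"
    and d :: "nat \<Rightarrow> ('v symb, 'v wvertex, 'k) free_elem \<Rightarrow> ('v symb, 'v wvertex, 'k) free_elem"
    and FC :: "nat \<Rightarrow> 'v wvertex monomial \<Rightarrow> ('v symb, 'v wvertex, 'k) free_elem set"
  assumes "simple_graph V E"
    and "clique_partition V E r W"
    and "\<forall>a\<in>{1..r}. bij_betw (x a) {1..card (W a)} (W a)"
    and "\<forall>a\<in>{1..r}. n a > 0"
  defines "V\<Gamma> \<equiv> whiskered_vertices V r n"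
    and "E\<Gamma> \<equiv> whiskered_edges E r W n"
    and "S \<equiv> poly_ring V\<Gamma>"
    and "J \<equiv> cover_ideal V\<Gamma> E\<Gamma>"
    and "F \<equiv> cover_module V E r W n"
    and "d \<equiv> (\<lambda>_. differential r W n x)"
    and "FC \<equiv> (\<lambda>p. free_component V\<Gamma> (symbols V E r W n p) symbol_deg)"
  shows "minimal_free_resolution S (irrelevant_ideal V\<Gamma>) F d augmentation (ideal_module J)
    \<and> (\<forall>m. augmentation ` FC 0 m \<subseteq> poly_component J m)
    \<and> (\<forall>p>0. \<forall>m. d p ` FC p m \<subseteq> FC (p - 1) m)"
proof -
  interpret whiskered_clique_partition V E r W x n
    by unfold_locales fact+
  show ?thesis
    unfolding minimal_free_resolution_def V\<Gamma>_def E\<Gamma>_def S_def J_def F_def d_def FC_def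
    using free_resolution_cover_ideal boundary_minimal augmentation_homogeneous boundary_homogeneous
    by (intro conjI allI impI image_subsetI)
qed

end
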